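(* Every nonzero homogeneous-quadratic homogeneous-symplectic Lie superalgebra $(\mathfrak g,B,\omega)$ over an algebraically closed field $\mathbb K$ of characteristic zero (where $B$ is even or odd, and $\omega$ is even or odd) is a special homogeneous-symplectic homogeneous-Manin superalgebra $(\mathfrak g=\mathfrak a\oplus\mathfrak b,B,\omega)$: there exist Lie sub-superalgebras $\mathfrak a,\mathfrak b$ of $\mathfrak g$ with $\mathfrak g=\mathfrak a\oplus\mathfrak b$ as vector spaces, $B(\mathfrak a,\mathfrak a)=B(\mathfrak b,\mathfrak b)=\{0\}$ and $\omega(\mathfrak a,\mathfrak a)=\omega(\mathfrak b,\mathfrak b)=\{0\}$. Moreover, we have either $\mathfrak z(\mathfrak g)\cap\mathfrak a\ne\{0\}$ or $\mathfrak z(\mathfrak g)\cap\mathfrak b\neq\{0\}$.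
   Context: All Lie superalgebras are finite dimensional; $|x|\in\mathbb Z_2$ is the degree of a homogeneous $X$; $\mathfrak z(\mathfrak g)$ is the center. A bilinear form $\theta$ is even if $\theta(\mathfrak g_\alpha,\mathfrak g_\beta)=\{0\}$ for $\alpha\ne\beta$, odd if $\theta(\mathfrak g_\alpha,\mathfrak g_\alpha)=\{0\}$ for all $\alpha$; homogeneous means even or odd. A homogeneous-quadratic structure $B$ is a homogeneous, supersymmetric ($B(X,Y)=(-1)^{|x||y|}B(Y,X)$), invariant ($B([X,Y],Z)=B(X,[Y,Z])$), non-degenerate bilinear form. A homogeneous-symplectic structure $\omega$ is a homogeneous, skew-supersymmetric ($\omega(X,Y)=-(-1)^{|x||y|}\omega(Y,X)$), non-degenerate bilinear form with $(-1)^{|z||x|}\omega(X,[Y,Z])+(-1)^{|x||y|}\omega(Y,[Z,X])+(-1)^{|y||z|}\omega(Z,[X,Y])=0$. A homogeneous-Manin superalgebra is a Lie superalgebra $\mathfrak g=\mathfrak a\oplus\mathfrak b$, a vector space direct sum of two Lie sub-superalgebras, with a homogeneous-quadratic structure $B$ for which $\mathfrak a,\mathfrak b$ are totally isotropic; it is special homogeneous-symplectic if it carries a homogeneous-symplectic structure $\omega$ with $\omega(\mathfrak a,\mathfrak a)=\omega(\mathfrak b,\mathfrak b)=\{0\}$. *)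

theory Defs
  imports "HOL-Computational_Algebra.Polynomial" "HOL-Library.Z2"
begin

text \<open>
  Degrees are elements of the two-element field \<^typ>\<open>bit\<close>. The sign below is
  $(-1)^{\alpha\beta}$.
\<close>

definition super_sign :: "bit \<Rightarrow> bit \<Rightarrow> 'k::comm_ring_1" where
  "super_sign \<alpha> \<beta> = (if \<alpha> = 1 \<and> \<beta> = 1 then - 1 else 1)"

definition bilinear_map ::
    "('k::field \<Rightarrow> 'a::ab_group_add \<Rightarrow> 'a) \<Rightarrow> ('k \<Rightarrow> 'b::ab_group_add \<Rightarrow> 'b) \<Rightarrow> ('a \<Rightarrow> 'a \<Rightarrow> 'b) \<Rightarrow> bool"
  where
  "bilinear_map s t f \<longleftrightarrow>
     (\<forall>x. Vector_Spaces.linear s t (f x)) \<and> (\<forall>y. Vector_Spaces.linear s t (\<lambda>x. f x y))"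

definition direct_sum :: "'a::ab_group_add set \<Rightarrow> 'a set \<Rightarrow> 'a set \<Rightarrow> bool" where
  "direct_sum U V W \<longleftrightarrow> W = {u + v |u v. u \<in> U \<and> v \<in> V} \<and> U \<inter> V = {0}"

text \<open>
  The underlying vector space is the whole type \<^typ>\<open>'a\<close>, and \<open>G \<alpha>\<close> is its homogeneous component
  of degree \<open>\<alpha>\<close>. The usual supplementary axioms for the bracket of odd elements over fields of
  characteristic 2 or 3 are not included; below, the field always has characteristic zero.
\<close>

locale lie_superalgebra = vector_space scale
  for scale :: "'k::field \<Rightarrow> 'a::ab_group_add \<Rightarrow> 'a" +
  fixes G :: "bit \<Rightarrow> 'a set"
    and bracket :: "'a \<Rightarrow> 'a \<Rightarrow> 'a"
  assumes finite_dimensional: "\<exists>S. finite S \<and> span S = UNIV"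
    and subspace_component: "subspace (G \<alpha>)"
    and grading: "direct_sum (G 0) (G 1) UNIV"
    and bracket_bilinear: "bilinear_map scale scale bracket"
    and bracket_degree: "x \<in> G \<alpha> \<Longrightarrow> y \<in> G \<beta> \<Longrightarrow> bracket x y \<in> G (\<alpha> + \<beta>)"
    and bracket_skew: "x \<in> G \<alpha> \<Longrightarrow> y \<in> G \<beta> \<Longrightarrow>
          bracket x y = scale (- super_sign \<alpha> \<beta>) (bracket y x)"
    and super_jacobi: "x \<in> G \<alpha> \<Longrightarrow> y \<in> G \<beta> \<Longrightarrow> z \<in> G \<gamma> \<Longrightarrow>
          scale (super_sign \<gamma> \<alpha>) (bracket x (bracket y z)) +
          scale (super_sign \<alpha> \<beta>) (bracket y (bracket z x)) +
          scale (super_sign \<beta> \<gamma>) (bracket z (bracket x y)) = 0"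
begin

definition center :: "'a set" where
  "center = {x. \<forall>y. bracket x y = 0}"

text \<open>A sub-superalgebra is a \<^emph>\<open>graded\<close> subspace closed under the bracket.\<close>

definition lie_sub_superalgebra :: "'a set \<Rightarrow> bool" where
  "lie_sub_superalgebra \<aa> \<longleftrightarrow>
     subspace \<aa> \<and> direct_sum (\<aa> \<inter> G 0) (\<aa> \<inter> G 1) \<aa> \<and> (\<forall>x\<in>\<aa>. \<forall>y\<in>\<aa>. bracket x y \<in> \<aa>)"

definition even_form :: "('a \<Rightarrow> 'a \<Rightarrow> 'k) \<Rightarrow> bool" where
  "even_form \<theta> \<longleftrightarrow> (\<forall>\<alpha> \<beta>. \<alpha> \<noteq> \<beta> \<longrightarrow> (\<forall>x\<in>G \<alpha>. \<forall>y\<in>G \<beta>. \<theta> x y = 0))"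

definition odd_form :: "('a \<Rightarrow> 'a \<Rightarrow> 'k) \<Rightarrow> bool" where
  "odd_form \<theta> \<longleftrightarrow> (\<forall>\<alpha>. \<forall>x\<in>G \<alpha>. \<forall>y\<in>G \<alpha>. \<theta> x y = 0)"

definition homogeneous_form :: "('a \<Rightarrow> 'a \<Rightarrow> 'k) \<Rightarrow> bool" where
  "homogeneous_form \<theta> \<longleftrightarrow> even_form \<theta> \<or> odd_form \<theta>"

definition bilinear_form :: "('a \<Rightarrow> 'a \<Rightarrow> 'k) \<Rightarrow> bool" where
  "bilinear_form \<theta> \<longleftrightarrow> bilinear_map scale (*) \<theta>"

definition nondegenerate :: "('a \<Rightarrow> 'a \<Rightarrow> 'k) \<Rightarrow> bool" where
  "nondegenerate \<theta> \<longleftrightarrow>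
     (\<forall>x. (\<forall>y. \<theta> x y = 0) \<longrightarrow> x = 0) \<and> (\<forall>y. (\<forall>x. \<theta> x y = 0) \<longrightarrow> y = 0)"

definition supersymmetric :: "('a \<Rightarrow> 'a \<Rightarrow> 'k) \<Rightarrow> bool" where
  "supersymmetric \<theta> \<longleftrightarrow>
     (\<forall>\<alpha> \<beta>. \<forall>x\<in>G \<alpha>. \<forall>y\<in>G \<beta>. \<theta> x y = super_sign \<alpha> \<beta> * \<theta> y x)"

definition skew_supersymmetric :: "('a \<Rightarrow> 'a \<Rightarrow> 'k) \<Rightarrow> bool" where
  "skew_supersymmetric \<theta> \<longleftrightarrow>
     (\<forall>\<alpha> \<beta>. \<forall>x\<in>G \<alpha>. \<forall>y\<in>G \<beta>. \<theta> x y = - super_sign \<alpha> \<beta> * \<theta> y x)"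

definition invariant_form :: "('a \<Rightarrow> 'a \<Rightarrow> 'k) \<Rightarrow> bool" where
  "invariant_form \<theta> \<longleftrightarrow> (\<forall>x y z. \<theta> (bracket x y) z = \<theta> x (bracket y z))"

definition closed_form :: "('a \<Rightarrow> 'a \<Rightarrow> 'k) \<Rightarrow> bool" where
  "closed_form \<theta> \<longleftrightarrow>
     (\<forall>\<alpha> \<beta> \<gamma>. \<forall>x\<in>G \<alpha>. \<forall>y\<in>G \<beta>. \<forall>z\<in>G \<gamma>.
        super_sign \<gamma> \<alpha> * \<theta> x (bracket y z) +
        super_sign \<alpha> \<beta> * \<theta> y (bracket z x) +
        super_sign \<beta> \<gamma> * \<theta> z (bracket x y) = 0)"

definition homogeneous_quadratic :: "('a \<Rightarrow> 'a \<Rightarrow> 'k) \<Rightarrow> bool" where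
  "homogeneous_quadratic B \<longleftrightarrow>
     bilinear_form B \<and> homogeneous_form B \<and> supersymmetric B \<and> invariant_form B \<and> nondegenerate B"

definition homogeneous_symplectic :: "('a \<Rightarrow> 'a \<Rightarrow> 'k) \<Rightarrow> bool" where
  "homogeneous_symplectic \<omega> \<longleftrightarrow>
     bilinear_form \<omega> \<and> homogeneous_form \<omega> \<and> skew_supersymmetric \<omega> \<and> nondegenerate \<omega> \<and> closed_form \<omega>"

definition totally_isotropic :: "('a \<Rightarrow> 'a \<Rightarrow> 'k) \<Rightarrow> 'a set \<Rightarrow> bool" where
  "totally_isotropic \<theta> \<aa> \<longleftrightarrow> (\<forall>x\<in>\<aa>. \<forall>y\<in>\<aa>. \<theta> x y = 0)"

definition homogeneous_manin :: "'a set \<Rightarrow> 'a set \<Rightarrow> ('a \<Rightarrow> 'a \<Rightarrow> 'k) \<Rightarrow> bool" where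
  "homogeneous_manin \<aa> \<bb> B \<longleftrightarrow>
     lie_sub_superalgebra \<aa> \<and> lie_sub_superalgebra \<bb> \<and> direct_sum \<aa> \<bb> UNIV \<and>
     homogeneous_quadratic B \<and> totally_isotropic B \<aa> \<and> totally_isotropic B \<bb>"

definition special_homogeneous_symplectic_manin ::
    "'a set \<Rightarrow> 'a set \<Rightarrow> ('a \<Rightarrow> 'a \<Rightarrow> 'k) \<Rightarrow> ('a \<Rightarrow> 'a \<Rightarrow> 'k) \<Rightarrow> bool" where
  "special_homogeneous_symplectic_manin \<aa> \<bb> B \<omega> \<longleftrightarrow>
     homogeneous_manin \<aa> \<bb> B \<and> homogeneous_symplectic \<omega> \<and>
     totally_isotropic \<omega> \<aa> \<and> totally_isotropic \<omega> \<bb>"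

end

end

theory Submission
  imports Defs
begin

text \<open>
  Non-degeneracy of \<open>B\<close> gives an operator \<open>D\<close> with \<open>\<omega>(x,y) = B(D x, y)\<close>. Closedness of \<open>\<omega>\<close> says that
  \<open>D\<close> is a superderivation, the symmetries of the two forms that it is skew for \<open>B\<close>, and
  non-degeneracy of \<open>\<omega>\<close> that it is injective; its degree \<open>p\<close> is the sum of the degrees of the forms.
  Let \<open>E = D\<close> if \<open>p = 0\<close> and \<open>E = D\<^sup>2\<close> if \<open>p = 1\<close>. In both cases \<open>E\<close> is an even, injective
  derivation, skew for \<open>B\<close>, that commutes with \<open>D\<close>. This treats the four combinations of parities
  at once.

  Decompose the algebra into the generalized eigenspaces \<open>V\<^sub>\<kappa>\<close> of \<open>E\<close> (\<open>span_gen_eigenspaces\<close>). As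
  \<open>E\<close> is a derivation, \<open>[V\<^sub>\<kappa>, V\<^sub>\<mu>]\<close> lies in \<open>V\<close> for \<open>\<kappa> + \<mu>\<close>; as \<open>E\<close> is skew, \<open>B(V\<^sub>\<kappa>, V\<^sub>\<mu>) = 0\<close> unless
  \<open>\<kappa> + \<mu> = 0\<close>; as \<open>E\<close> is injective, \<open>V\<^sub>0 = 0\<close>. The additive group of the field can be ordered
  (\<open>ex_positive_cone\<close>). The sum \<open>\<aa>\<close> of the \<open>V\<^sub>\<kappa>\<close> with \<open>\<kappa>\<close> positive and the sum \<open>\<bb>\<close> of those with
  \<open>\<kappa>\<close> negative are then complementary subalgebras, isotropic for \<open>B\<close> (\<open>weight_sum_manin\<close>). They are
  graded because \<open>E\<close> is even, and isotropic for \<open>\<omega>\<close> because \<open>D\<close> commutes with \<open>E\<close> and so preserves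
  them.

  For the center, note that \<open>ad x\<close> is nilpotent for each \<open>x \<in> V\<^sub>\<kappa>\<close>, since \<open>\<kappa> \<noteq> 0\<close> and only finitely
  many eigenvalues occur. Engel's theorem, proved for homogeneous weight vectors
  (\<open>superalgebra_nilpotent\<close>), shows that the whole algebra acts nilpotently on itself. A nonzero
  algebra therefore has a nonzero central vector, and it can be found inside a single \<open>V\<^sub>\<kappa>\<close>, hence in
  \<open>\<aa>\<close> or in \<open>\<bb>\<close>.
\<close>

section \<open>Vectors annihilated by iterating a set of operators\<close>

text \<open>
  The limit of the (possibly transfinite) ascending series in which each step consists of the
  vectors that all operators send into the previous one. One operator \<open>E - \<kappa>\<close> gives a generalized
  eigenspace of \<open>E\<close>; the adjoint operators of a finite-dimensional subalgebra act nilpotently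
  exactly if everything is reached. The induction rule replaces the counting of exponents. The
  first clause is needed since \<open>0\<close> would otherwise have to precede itself.
\<close>

inductive_set nil_part :: "('a::zero \<Rightarrow> 'a) set \<Rightarrow> 'a set" for \<Phi> where
  zero: "0 \<in> nil_part \<Phi>"
| step: "(\<And>\<phi>. \<phi> \<in> \<Phi> \<Longrightarrow> \<phi> v \<in> nil_part \<Phi>) \<Longrightarrow> v \<in> nil_part \<Phi>"

lemma nil_part_stable:
  assumes "v \<in> nil_part \<Phi>" "\<phi> \<in> \<Phi>" "\<phi> 0 = 0"
  shows "\<phi> v \<in> nil_part \<Phi>"
  using assms by (cases) (auto intro: nil_part.zero)

lemma nil_part_funpow:
  assumes "(\<phi> ^^ n) v = 0"
  shows "v \<in> nil_part {\<phi>}"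
  using assms
proof (induction n arbitrary: v)
  case 0
  then show ?case by (simp add: nil_part.zero)
next
  case (Suc n)
  then have "\<phi> v \<in> nil_part {\<phi>}"
    by (simp add: funpow_swap1)
  then show ?case by (auto intro: nil_part.step)
qed

text \<open>
  The last vector outside \<open>U\<close> on a path of operator images; it replaces the common eigenvector
  in a quotient module in the usual proof of Engel's theorem, and \<open>S\<close> keeps the vector homogeneous.
\<close>

lemma nil_part_last_outside:
  assumes "v \<in> nil_part \<Phi>" "v \<in> S" "v \<notin> U" "0 \<in> U"
    and stable: "\<And>\<phi> s. \<phi> \<in> \<Phi> \<Longrightarrow> s \<in> S \<Longrightarrow> \<phi> s \<in> S"
  shows "\<exists>x\<in>S - U. \<forall>\<phi>\<in>\<Phi>. \<phi> x \<in> U"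
  using assms(1-3)
proof induction
  case zero
  with \<open>0 \<in> U\<close> show ?case by blast
next
  case (step v)
  then show ?case using stable by blast
qed

lemma subspace_nil_part:
  assumes "vector_space scale"
    and lin: "\<And>\<phi>. \<phi> \<in> \<Phi> \<Longrightarrow> Vector_Spaces.linear scale scale \<phi>"
  shows "module.subspace scale (nil_part \<Phi>)"
proof -
  interpret vector_space scale by fact
  show ?thesis
  proof (rule subspaceI)
    show "0 \<in> nil_part \<Phi>" by (rule nil_part.zero)
  next
    fix x y assume x: "x \<in> nil_part \<Phi>" and y: "y \<in> nil_part \<Phi>"
    from x y show "x + y \<in> nil_part \<Phi>"
    proof (induction arbitrary: y)
      case zero
      then show ?case by simp
    next
      case (step x)
      show ?case
      proof (rule nil_part.step)
        fix \<phi> assume \<phi>: "\<phi> \<in> \<Phi>"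
        interpret \<phi>: Vector_Spaces.linear scale scale \<phi> by (rule lin[OF \<phi>])
        have "\<phi> y \<in> nil_part \<Phi>"
          using nil_part_stable[OF step.prems \<phi> \<phi>.zero] .
        with step.IH[OF \<phi>] show "\<phi> (x + y) \<in> nil_part \<Phi>"
          by (simp add: \<phi>.add)
      qed
    qed
  next
    fix c x assume "x \<in> nil_part \<Phi>"
    then show "scale c x \<in> nil_part \<Phi>"
    proof induction
      case zero
      then show ?case by (simp add: nil_part.zero)
    next
      case (step x)
      show ?case
      proof (rule nil_part.step)
        fix \<phi> assume \<phi>: "\<phi> \<in> \<Phi>"
        interpret \<phi>: Vector_Spaces.linear scale scale \<phi> by (rule lin[OF \<phi>])
        show "\<phi> (scale c x) \<in> nil_part \<Phi>"
          using step.IH[OF \<phi>] by (simp add: \<phi>.scale)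
      qed
    qed
  qed
qed

section \<open>Generalized eigenspaces\<close>

locale linear_operator = vector_space scale
  for scale :: "'k::alg_closed_field \<Rightarrow> 'a::ab_group_add \<Rightarrow> 'a" +
  fixes E :: "'a \<Rightarrow> 'a"
  assumes E_linear: "Vector_Spaces.linear scale scale E"
begin

sublocale E: Vector_Spaces.linear scale scale E by (rule E_linear)

definition gen_eigenspace :: "'k \<Rightarrow> 'a set" where
  "gen_eigenspace \<kappa> = nil_part {\<lambda>x. E x - scale \<kappa> x}"

lemma zero_in_gen_eigenspace: "0 \<in> gen_eigenspace \<kappa>"
  unfolding gen_eigenspace_def by (rule nil_part.zero)

lemma gen_eigenspaceI:
  "E x - scale \<kappa> x \<in> gen_eigenspace \<kappa> \<Longrightarrow> x \<in> gen_eigenspace \<kappa>"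
  unfolding gen_eigenspace_def by (rule nil_part.step) auto

lemma gen_eigenspace_induct [consumes 1, case_names zero step]:
  assumes "x \<in> gen_eigenspace \<kappa>"
    and "P 0"
    and "\<And>x. E x - scale \<kappa> x \<in> gen_eigenspace \<kappa> \<Longrightarrow> P (E x - scale \<kappa> x) \<Longrightarrow> P x"
  shows "P x"
  using assms(1) unfolding gen_eigenspace_def
proof induction
  case zero
  show ?case by (rule assms(2))
next
  case (step v)
  then show ?case using assms(3)[of v] by (simp add: gen_eigenspace_def)
qed

lemma linear_shift: "Vector_Spaces.linear scale scale (\<lambda>x. E x - scale \<kappa> x)"
  by unfold_locales (simp_all add: E.add E.scale algebra_simps)

lemma subspace_gen_eigenspace: "subspace (gen_eigenspace \<kappa>)"
  unfolding gen_eigenspace_def 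
  by (rule subspace_nil_part[OF vector_space_axioms]) (auto intro: linear_shift)

lemma gen_eigenspace_commuting_stable:
  assumes "Vector_Spaces.linear scale scale D" and comm: "\<And>x. D (E x) = E (D x)"
    and "x \<in> gen_eigenspace \<kappa>"
  shows "D x \<in> gen_eigenspace \<kappa>"
  using assms(3)
proof (induction rule: gen_eigenspace_induct)
  interpret D: Vector_Spaces.linear scale scale D by fact
  case zero
  show ?case by (simp add: D.zero zero_in_gen_eigenspace)
next
  interpret D: Vector_Spaces.linear scale scale D by fact
  case (step x)
  then have "E (D x) - scale \<kappa> (D x) \<in> gen_eigenspace \<kappa>"
    by (simp add: D.diff D.scale comm)
  then show ?case by (rule gen_eigenspaceI)
qed

lemma gen_eigenspace_zero_trivial:
  assumes inj: "\<And>x. E x = 0 \<Longrightarrow> x = 0" and "x \<in> gen_eigenspace 0"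
  shows "x = 0"
  using assms(2) by (induction rule: gen_eigenspace_induct) (auto intro: inj)

text \<open>
  On a generalized eigenspace, \<open>E - \<kappa>\<close> for another \<open>\<kappa>\<close> is a nonzero scalar plus a locally nilpotent
  operator. The induction is the geometric series for its inverse.
\<close>

lemma shift_surj_on_gen_eigenspace:
  assumes "\<kappa> \<noteq> \<mu>" "x \<in> gen_eigenspace \<mu>"
  shows "\<exists>u\<in>gen_eigenspace \<mu>. E u - scale \<kappa> u = x"
  using assms(2)
proof (induction rule: gen_eigenspace_induct)
  case zero
  show ?case by (rule bexI[of _ 0]) (simp_all add: E.zero zero_in_gen_eigenspace)
next
  case (step x)
  interpret S: Vector_Spaces.linear scale scale "\<lambda>x. E x - scale \<kappa> x"
    by (rule linear_shift)
  from step obtain u where u: "u \<in> gen_eigenspace \<mu>" and eq: "E u - scale \<kappa> u = E x - scale \<mu> x"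
    by blast
  have x: "x \<in> gen_eigenspace \<mu>"
    using step.hyps by (rule gen_eigenspaceI)
  define w where "w = scale (inverse (\<mu> - \<kappa>)) (x - u)"
  have "E (x - u) - scale \<kappa> (x - u) = (E x - scale \<kappa> x) - (E u - scale \<kappa> u)"
    by (simp add: E.diff algebra_simps)
  also have "\<dots> = scale (\<mu> - \<kappa>) x"
    unfolding eq by (simp add: algebra_simps)
  finally have "E (x - u) - scale \<kappa> (x - u) = scale (\<mu> - \<kappa>) x" .
  then have "scale (inverse (\<mu> - \<kappa>)) (E (x - u) - scale \<kappa> (x - u)) = x"
    using \<open>\<kappa> \<noteq> \<mu>\<close> by simp
  then have "E w - scale \<kappa> w = x"
    using S.scale[of "inverse (\<mu> - \<kappa>)" "x - u"] by (simp only: w_def)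
  moreover have "w \<in> gen_eigenspace \<mu>"
    unfolding w_def using x u by (intro subspace_scale subspace_diff subspace_gen_eigenspace)
  ultimately show ?case by blast
qed

text \<open>
  The operators \<open>E - \<kappa>\<close> are injective modulo the sum of the generalized eigenspaces: a preimage can
  be corrected by vectors of the eigenspaces for the other eigenvalues until its image lies in
  the one for \<open>\<kappa>\<close>.
\<close>

lemma span_gen_eigenspaces_unshift:
  assumes "E v - scale \<kappa> v \<in> span (\<Union>\<mu>. gen_eigenspace \<mu>)"
  shows "v \<in> span (\<Union>\<mu>. gen_eigenspace \<mu>)"
proof -
  let ?W = "span (\<Union>\<mu>. gen_eigenspace \<mu>)"
  interpret S: Vector_Spaces.linear scale scale "\<lambda>x. E x - scale \<kappa> x"
    by (rule linear_shift)
  have "\<exists>u\<in>?W. w - (E u - scale \<kappa> u) \<in> gen_eigenspace \<kappa>" if "w \<in> ?W" for w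
    using that
  proof (induction rule: span_induct_alt)
    case base
    show ?case
      by (rule bexI[of _ 0]) (simp_all add: S.zero zero_in_gen_eigenspace span_zero)
  next
    case (step c x y)
    then obtain u where u: "u \<in> ?W" "y - (E u - scale \<kappa> u) \<in> gen_eigenspace \<kappa>"
      by blast
    from step obtain \<mu> where x: "x \<in> gen_eigenspace \<mu>" by blast
    obtain u' where u': "u' \<in> ?W" "x - (E u' - scale \<kappa> u') \<in> gen_eigenspace \<kappa>"
    proof (cases "\<kappa> = \<mu>")
      case True
      with x show thesis
        by (intro that[of 0]) (simp_all add: S.zero span_zero)
    next
      case False
      with shift_surj_on_gen_eigenspace[OF _ x] obtain u' where
        "u' \<in> gen_eigenspace \<mu>" "E u' - scale \<kappa> u' = x" by blast
      then show thesis
        by (intro that[of u']) (auto intro: span_base zero_in_gen_eigenspace)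
    qed
    have "scale c u' + u \<in> ?W"
      using u u' by (intro span_add span_scale)
    moreover have "scale c x + y - (E (scale c u' + u) - scale \<kappa> (scale c u' + u)) =
        scale c (x - (E u' - scale \<kappa> u')) + (y - (E u - scale \<kappa> u))"
      by (simp only: S.add S.scale scale_right_diff_distrib) (simp add: algebra_simps)
    moreover have "\<dots> \<in> gen_eigenspace \<kappa>"
      using u u' by (intro subspace_add subspace_scale subspace_gen_eigenspace)
    ultimately show ?case by metis
  qed
  from this[OF assms] obtain u where u: "u \<in> ?W"
    and "E v - scale \<kappa> v - (E u - scale \<kappa> u) \<in> gen_eigenspace \<kappa>" by blast
  then have "E (v - u) - scale \<kappa> (v - u) \<in> gen_eigenspace \<kappa>"
    by (simp only: S.diff)
  then have "v - u \<in> ?W"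
    by (intro span_base UN_I[of \<kappa>] UNIV_I gen_eigenspaceI[of "v - u"])
  from span_add[OF this u] show ?thesis by simp
qed

definition poly_act :: "'k poly \<Rightarrow> 'a \<Rightarrow> 'a" where
  "poly_act p v = (\<Sum>i\<le>degree p. scale (coeff p i) ((E ^^ i) v))"

lemma poly_act_eq:
  assumes "degree p \<le> n"
  shows "poly_act p v = (\<Sum>i\<le>n. scale (coeff p i) ((E ^^ i) v))"
  unfolding poly_act_def using assms
  by (intro sum.mono_neutral_left) (auto simp: coeff_eq_0)

lemma poly_act_linear_factor:
  "poly_act ([:- \<kappa>, 1:] * q) v = E (poly_act q v) - scale \<kappa> (poly_act q v)"
proof -
  define n where "n = degree q"
  let ?f = "\<lambda>i. (E ^^ i) v"
  have "degree ([:- \<kappa>, 1:] * q) \<le> Suc n"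
    unfolding n_def using degree_mult_le[of "[:- \<kappa>, 1:]" q] by simp
  then have "poly_act ([:- \<kappa>, 1:] * q) v =
      (\<Sum>i\<le>Suc n. scale (coeff ([:- \<kappa>, 1:] * q) i) (?f i))"
    by (rule poly_act_eq)
  also have "\<dots> = (\<Sum>i\<le>Suc n. scale (coeff (pCons 0 q) i) (?f i)) -
      scale \<kappa> (\<Sum>i\<le>Suc n. scale (coeff q i) (?f i))"
    by (simp add: algebra_simps sum_subtractf scale_sum_right del: sum.atMost_Suc)
  also have "(\<Sum>i\<le>Suc n. scale (coeff q i) (?f i)) = poly_act q v"
    by (rule poly_act_eq[symmetric]) (simp add: n_def)
  also have "(\<Sum>i\<le>Suc n. scale (coeff (pCons 0 q) i) (?f i)) =
      E (\<Sum>i\<le>n. scale (coeff q i) (?f i))"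
    by (simp add: sum.atMost_Suc_shift E.sum E.scale del: sum.atMost_Suc)
  also have "(\<Sum>i\<le>n. scale (coeff q i) (?f i)) = poly_act q v"
    by (rule poly_act_eq[symmetric]) (simp add: n_def)
  finally show ?thesis .
qed

text \<open>
  The iterated images of \<open>v\<close> are linearly dependent, either as a set that is infinite or because
  two of them coincide.
\<close>

lemma ex_poly_act_eq_0:
  assumes "finite S" "span S = UNIV"
  shows "\<exists>p. p \<noteq> 0 \<and> poly_act p v = 0"
proof -
  let ?f = "\<lambda>i. (E ^^ i) v"
  have "\<exists>c n j. j \<le> n \<and> c j \<noteq> 0 \<and> (\<Sum>i\<le>n. scale (c i) (?f i)) = 0"
  proof (cases "inj ?f")
    case True
    then have "infinite (range ?f)"
      using finite_imageD by blast
    then have "dependent (range ?f)"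
      using independent_span_bound[of S "range ?f"] assms by auto
    then obtain T u where T: "finite T" "T \<subseteq> range ?f" "(\<Sum>w\<in>T. scale (u w) w) = 0"
      "\<exists>w\<in>T. u w \<noteq> 0"
      unfolding dependent_explicit by blast
    define I where "I = {i. ?f i \<in> T}"
    have I: "finite I"
      unfolding I_def using finite_vimageI[OF T(1) True] by (simp add: vimage_def)
    have "?f ` I = T"
      using T(2) by (auto simp: I_def)
    then have "(\<Sum>w\<in>T. scale (u w) w) = (\<Sum>i\<in>I. scale (u (?f i)) (?f i))"
      using sum.reindex[of ?f I "\<lambda>w. scale (u w) w"] inj_on_subset[OF True, of I] by simp
    also have "\<dots> = (\<Sum>i\<le>Max I. scale (if i \<in> I then u (?f i) else 0) (?f i))"
      using I by (intro sum.mono_neutral_cong_left) auto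
    finally have "(\<Sum>i\<le>Max I. scale (if i \<in> I then u (?f i) else 0) (?f i)) = 0"
      using T(3) by simp
    moreover obtain j where "j \<in> I" "u (?f j) \<noteq> 0"
      using T(4) \<open>?f ` I = T\<close> by blast
    ultimately show ?thesis
      using I by (intro exI[of _ "\<lambda>i. if i \<in> I then u (?f i) else 0"] exI[of _ "Max I"]
          exI[of _ j]) auto
  next
    case False
    then obtain i j where ij: "?f i = ?f j" "i < j"
      unfolding inj_def by (metis linorder_neqE_nat)
    let ?c = "\<lambda>k. (if k = i then 1 else 0) - (if k = j then 1 else 0)"
    have "(\<Sum>k\<le>j. scale (?c k) (?f k)) =
        (\<Sum>k\<le>j. (if k = i then ?f k else 0) - (if k = j then ?f k else 0))"
      by (intro sum.cong) auto
    also have "\<dots> = 0"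
      using ij by (simp add: sum_subtractf)
    finally show ?thesis
      using ij(2) by (intro exI[of _ ?c] exI[of _ j] exI[of _ j]) auto
  qed
  then obtain c n j where c: "j \<le> n" "c j \<noteq> 0" "(\<Sum>i\<le>n. scale (c i) (?f i)) = 0"
    by blast
  define p where "p = Poly (map c [0..<Suc n])"
  have coeff_p: "coeff p i = (if i \<le> n then c i else 0)" for i
    by (simp add: p_def nth_default_def del: upt_Suc)
  have "degree p \<le> n"
    by (rule degree_le) (simp add: coeff_p)
  then have "poly_act p v = 0"
    using c(3) by (simp add: poly_act_eq coeff_p)
  moreover have "p \<noteq> 0"
    using c(1,2) coeff_p[of j] by auto
  ultimately show ?thesis by blast
qed

text \<open>
  Some nonzero polynomial in \<open>E\<close> sends a given vector to \<open>0\<close>, hence into the sum of the generalized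
  eigenspaces. Since \<open>E - \<kappa>\<close> is injective modulo that sum, its linear factors can be cancelled one
  at a time.
\<close>

lemma span_gen_eigenspaces:
  assumes S: "finite S" "span S = UNIV"
  shows "span (\<Union>\<kappa>. gen_eigenspace \<kappa>) = UNIV"
proof -
  let ?W = "span (\<Union>\<kappa>. gen_eigenspace \<kappa>)"
  have *: "v \<in> ?W" if "p \<noteq> 0" "poly_act p v \<in> ?W" for p v
    using that
  proof (induction "degree p" arbitrary: p)
    case 0
    then obtain c where "p = [:c:]" "c \<noteq> 0"
      by (metis degree_eq_zeroE pCons_0_0)
    with 0 have "scale c v \<in> ?W"
      by (simp add: poly_act_def)
    from span_scale[OF this, of "inverse c"] \<open>c \<noteq> 0\<close> show ?case by simp
  next
    case (Suc n)
    then obtain \<kappa> where "poly p \<kappa> = 0"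
      using alg_closed_imp_poly_has_root[of p] by auto
    then obtain q where q: "p = [:- \<kappa>, 1:] * q"
      by (auto simp: poly_eq_0_iff_dvd)
    with Suc.prems have "q \<noteq> 0" by auto
    have "n = degree q"
      using Suc.hyps(2) \<open>q \<noteq> 0\<close> unfolding q by (subst (asm) degree_mult_eq) auto
    moreover have "poly_act q v \<in> ?W"
      using Suc.prems(2) unfolding q poly_act_linear_factor
      by (rule span_gen_eigenspaces_unshift)
    ultimately show ?case
      using Suc.hyps(1) \<open>q \<noteq> 0\<close> by blast
  qed
  have "v \<in> ?W" for v
  proof -
    obtain p where "p \<noteq> 0" "poly_act p v = 0"
      using ex_poly_act_eq_0[OF S] by blast
    with * show ?thesis by (simp add: span_zero)
  qed
  then show ?thesis by blast
qed

end

section \<open>Positive cones in fields of characteristic zero\<close>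

text \<open>
  An additive order on \<open>K\<close> exists because its additive group is torsion-free. By maximality, a
  nonzero \<open>x\<close> outside the cone has a negative multiple in it, for otherwise \<open>x\<close> could be
  adjoined. If \<open>-x\<close> is outside as well, a positive multiple of \<open>x\<close> also lies in the cone, and a
  combination of the two is \<open>0\<close>.
\<close>

lemma ex_positive_cone:
  obtains P :: "'k::field_char_0 set" where
    "0 \<notin> P" "\<And>x y. x \<in> P \<Longrightarrow> y \<in> P \<Longrightarrow> x + y \<in> P" "\<And>x. x \<noteq> 0 \<Longrightarrow> x \<in> P \<or> - x \<in> P"
proof -
  let ?\<A> = "{P :: 'k set. 0 \<notin> P \<and> (\<forall>x\<in>P. \<forall>y\<in>P. x + y \<in> P)}"
  have "\<exists>P\<in>?\<A>. \<forall>Q\<in>?\<A>. P \<subseteq> Q \<longrightarrow> Q = P"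
  proof (rule subset_Zorn')
    fix C assume C: "subset.chain ?\<A> C"
    have closed: "x + y \<in> X" if "x \<in> X" "y \<in> X" "X \<in> C" for x y X
      using C that by (auto simp: subset.chain_def)
    have "x + y \<in> \<Union>C" if xy: "x \<in> X" "X \<in> C" "y \<in> Y" "Y \<in> C" for x y X Y
    proof -
      from C xy have "X \<subseteq> Y \<or> Y \<subseteq> X"
        by (auto simp: subset.chain_def)
      then show ?thesis
        using closed xy by blast
    qed
    moreover have "0 \<notin> \<Union>C"
      using C by (auto simp: subset.chain_def)
    ultimately show "\<Union>C \<in> ?\<A>" by auto
  qed
  then obtain P where "P \<in> ?\<A>" and "\<forall>Q\<in>?\<A>. P \<subseteq> Q \<longrightarrow> Q = P" ..
  then have P: "0 \<notin> P" and P_add: "\<And>x y. x \<in> P \<Longrightarrow> y \<in> P \<Longrightarrow> x + y \<in> P"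
    and P_max: "\<And>Q. Q \<in> ?\<A> \<Longrightarrow> P \<subseteq> Q \<Longrightarrow> Q = P"
    by simp_all
  have P_mult: "of_nat (Suc n) * x \<in> P" if "x \<in> P" for n x
  proof (induction n)
    case (Suc n)
    have "of_nat (Suc (Suc n)) * x = of_nat (Suc n) * x + x"
      by (simp add: algebra_simps)
    with P_add[OF Suc that] show ?case by (simp only:)
  qed (use that in simp)
  have adjoin: "\<exists>n. - (of_nat (Suc n) * x) \<in> P" if "x \<noteq> 0" "x \<notin> P" for x
  proof (rule ccontr)
    assume neg: "\<not> ?thesis"
    define Q where "Q = P \<union> {q + of_nat (Suc n) * x |q n. q \<in> insert 0 P}"
    have "0 \<notin> Q"
    proof
      assume "0 \<in> Q"
      then obtain q n where q: "q \<in> insert 0 P" "q + of_nat (Suc n) * x = 0"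
        using P by (auto simp: Q_def)
      then have "q = - (of_nat (Suc n) * x)"
        by (simp add: eq_neg_iff_add_eq_0)
      moreover have "of_nat (Suc n) * x \<noteq> 0"
        using \<open>x \<noteq> 0\<close> by (simp del: of_nat_Suc)
      ultimately show False
        using q(1) neg by auto
    qed
    moreover have "u + v \<in> Q" if "u \<in> Q" "v \<in> Q" for u v
    proof -
      have repr: "\<exists>q n. w = q + of_nat n * x \<and> q \<in> insert 0 P \<and> (n = 0 \<longrightarrow> q \<in> P)" if "w \<in> Q" for w
      proof (cases "w \<in> P")
        case True
        then show ?thesis by (intro exI[of _ w] exI[of _ 0]) auto
      next
        case False
        with that obtain q n where "w = q + of_nat (Suc n) * x" "q \<in> insert 0 P"
          unfolding Q_def by blast
        then show ?thesis by (intro exI[of _ q] exI[of _ "Suc n"]) simp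
      qed
      from repr[OF that(1)] repr[OF that(2)] obtain q n q' m where
        q: "u = q + of_nat n * x" "q \<in> insert 0 P" "n = 0 \<longrightarrow> q \<in> P" and
        q': "v = q' + of_nat m * x" "q' \<in> insert 0 P" "m = 0 \<longrightarrow> q' \<in> P"
        by blast
      have eq: "u + v = (q + q') + of_nat (n + m) * x"
        using q q' by (simp add: algebra_simps)
      show ?thesis
      proof (cases "n + m")
        case 0
        with q q' eq show ?thesis by (auto simp: Q_def P_add)
      next
        case (Suc k)
        have "q + q' \<in> insert 0 P"
          using q(2) q'(2) by (auto simp: P_add)
        then show ?thesis unfolding eq Suc Q_def by blast
      qed
    qed
    ultimately have "Q = P"
      by (intro P_max) (auto simp: Q_def)
    moreover have "x \<in> Q"
      unfolding Q_def by (rule UnI2, rule CollectI, rule exI[of _ 0], rule exI[of _ 0]) simp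
    ultimately show False using \<open>x \<notin> P\<close> by blast
  qed
  have "x \<in> P \<or> - x \<in> P" if x: "x \<noteq> 0" for x
  proof (rule ccontr)
    assume "\<not> ?thesis"
    then have "x \<notin> P" "- x \<notin> P"
      by simp_all
    obtain n where "- (of_nat (Suc n) * x) \<in> P"
      using adjoin[OF x \<open>x \<notin> P\<close>] ..
    moreover
    obtain m where "- (of_nat (Suc m) * - x) \<in> P"
      using adjoin[of "- x"] x \<open>- x \<notin> P\<close> by auto
    then have "of_nat (Suc m) * x \<in> P"
      by (simp only: mult_minus_right minus_minus)
    ultimately have "of_nat (Suc m) * - (of_nat (Suc n) * x) + of_nat (Suc n) * (of_nat (Suc m) * x) \<in> P"
      by (rule P_add[OF P_mult P_mult])
    moreover have "of_nat (Suc m) * - (of_nat (Suc n) * x) +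
        of_nat (Suc n) * (of_nat (Suc m) * x) = 0"
      by (simp only: mult_minus_right mult.left_commute) simp
    ultimately show False using P by simp
  qed
  with P P_add show thesis by (rule that)
qed

section \<open>Bilinear maps and homogeneous elements\<close>

lemma bilinear_map_span:
  assumes bil: "bilinear_map s t f" and W: "module.subspace t W"
    and gens: "\<And>x y. x \<in> X \<Longrightarrow> y \<in> Y \<Longrightarrow> f x y \<in> W"
    and x: "x \<in> module.span s X" and y: "y \<in> module.span s Y"
  shows "f x y \<in> W"
proof -
  have lin: "Vector_Spaces.linear s t (f x)" "Vector_Spaces.linear s t (\<lambda>x. f x y)" for x y
    using bil by (auto simp: bilinear_map_def)
  have span: "g z \<in> W" if "Vector_Spaces.linear s t g" "z \<in> module.span s Z"
    "\<And>z. z \<in> Z \<Longrightarrow> g z \<in> W" for g z Z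
  proof -
    interpret g: Vector_Spaces.linear s t g by fact
    have "g ` Z \<subseteq> W" using that(3) by blast
    moreover have "g z \<in> g.vs2.span (g ` Z)"
      using that(2) by (simp add: g.span_image)
    ultimately show ?thesis
      using g.vs2.span_minimal[OF _ W] by blast
  qed
  have "f x' y \<in> W" if "x' \<in> X" for x'
    using span[OF lin(1) y] gens that by blast
  then show ?thesis
    using span[OF lin(2) x] by blast
qed

lemma vector_space_mult: "vector_space ((*) :: 'k::field \<Rightarrow> 'k \<Rightarrow> 'k)"
  by unfold_locales (simp_all add: algebra_simps)

lemma subspace_zero_mult: "module.subspace ((*) :: 'k::field \<Rightarrow> 'k \<Rightarrow> 'k) {0}"
proof -
  interpret vector_space "(*) :: 'k \<Rightarrow> 'k \<Rightarrow> 'k" by (rule vector_space_mult)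
  show ?thesis by (rule subspace_single_0)
qed

lemma bilinear_mapD:
  assumes "bilinear_map s t f"
  shows "f (x + x') y = f x y + f x' y" "f x (y + y') = f x y + f x y'"
    "f (x - x') y = f x y - f x' y" "f x (y - y') = f x y - f x y'"
    "f (s c x) y = t c (f x y)" "f x (s c y) = t c (f x y)"
    "f (- x) y = - f x y" "f x (- y) = - f x y"
    "f 0 y = 0" "f x 0 = 0"
proof -
  have lin: "Vector_Spaces.linear s t (f x)" "Vector_Spaces.linear s t (\<lambda>x. f x y)" for x y
    using assms by (auto simp: bilinear_map_def)
  interpret r: Vector_Spaces.linear s t "f x" by (rule lin)
  interpret l: Vector_Spaces.linear s t "\<lambda>x. f x y" by (rule lin)
  show "f (x + x') y = f x y + f x' y" "f x (y + y') = f x y + f x y'"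
    "f (x - x') y = f x y - f x' y" "f x (y - y') = f x y - f x y'"
    "f (s c x) y = t c (f x y)" "f x (s c y) = t c (f x y)"
    "f (- x) y = - f x y" "f x (- y) = - f x y"
    "f 0 y = 0" "f x 0 = 0"
    by (rule l.add r.add l.diff r.diff l.scale r.scale l.neg r.neg l.zero r.zero)+
qed

lemma super_sign_0 [simp]: "super_sign 0 \<beta> = 1" "super_sign \<alpha> 0 = 1"
  by (simp_all add: super_sign_def)

lemma super_sign_1_1 [simp]: "super_sign 1 1 = - 1"
  by (simp add: super_sign_def)

lemma bit_1_plus_1 [simp]: "1 + 1 = (0 :: bit)"
  using bit_2_eq_0 by (simp only: one_add_one)

context lie_superalgebra
begin

lemmas bracket_simps = bilinear_mapD[OF bracket_bilinear]

lemma linear_bracket: "Vector_Spaces.linear scale scale (bracket x)"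
  using bracket_bilinear by (simp add: bilinear_map_def)

lemma homogeneous_decomp: "\<exists>x0\<in>G 0. \<exists>x1\<in>G 1. x = x0 + x1"
proof -
  have "x \<in> {u + v |u v. u \<in> G 0 \<and> v \<in> G 1}"
    using grading unfolding direct_sum_def by blast
  then show ?thesis by blast
qed

lemma component_add: "x \<in> G \<alpha> \<Longrightarrow> y \<in> G \<alpha> \<Longrightarrow> x + y \<in> G \<alpha>"
  by (rule subspace_add[OF subspace_component])

lemma component_scale: "x \<in> G \<alpha> \<Longrightarrow> scale c x \<in> G \<alpha>"
  by (rule subspace_scale[OF subspace_component])

lemma component_disjoint:
  assumes "x \<in> G \<alpha>" "x \<in> G \<beta>" "\<alpha> \<noteq> \<beta>"
  shows "x = 0"
proof -
  have "G 0 \<inter> G 1 = {0}"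
    using grading by (simp add: direct_sum_def)
  then show ?thesis
    using assms by (cases \<alpha>; cases \<beta>) auto
qed

lemma homogeneous_induct [case_names homogeneous add]:
  assumes "\<And>\<alpha> x. x \<in> G \<alpha> \<Longrightarrow> P x" and "\<And>x y. P x \<Longrightarrow> P y \<Longrightarrow> P (x + y)"
  shows "P x"
  using homogeneous_decomp[of x] assms by blast

text \<open>
  Written as the statement that adjoint maps are superderivations, the super Jacobi identity allows
  an arbitrary last argument.
\<close>

lemma bracket_bracket:
  assumes x: "x \<in> G \<alpha>" and y: "y \<in> G \<beta>"
  shows "bracket x (bracket y z) =
    bracket (bracket x y) z + scale (super_sign \<alpha> \<beta>) (bracket y (bracket x z))"
proof (induction z rule: homogeneous_induct)
  case (homogeneous \<gamma> z)
  note J = super_jacobi[OF x y homogeneous]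
  have zx: "bracket y (bracket z x) = scale (- super_sign \<gamma> \<alpha>) (bracket y (bracket x z))"
    by (simp add: bracket_skew[OF homogeneous x] bracket_simps)
  have zxy: "bracket z (bracket x y) =
      scale (- super_sign \<gamma> (\<alpha> + \<beta>)) (bracket (bracket x y) z)"
    by (rule bracket_skew[OF homogeneous bracket_degree[OF x y]])
  from J show ?case
    unfolding zx zxy
    by (cases \<alpha>; cases \<beta>; cases \<gamma>) (simp_all add: algebra_simps add_eq_0_iff)
next
  case (add z z')
  then show ?case by (simp add: bracket_simps scale_right_distrib add_ac)
qed

lemma bracket_swap_in_subspace:
  assumes "subspace W" "x \<in> G \<alpha>" "y \<in> G \<beta>" "bracket x y \<in> W"
  shows "bracket y x \<in> W"
  unfolding bracket_skew[OF assms(3,2)] using assms(1,4) by (rule subspace_scale)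

end

section \<open>Weight spaces of an even invertible skew derivation\<close>

locale invertible_skew_derivation =
  lie_superalgebra scale G bracket + linear_operator scale E
  for scale :: "'k::{alg_closed_field, field_char_0} \<Rightarrow> 'a::ab_group_add \<Rightarrow> 'a"
    and G :: "bit \<Rightarrow> 'a set" and bracket :: "'a \<Rightarrow> 'a \<Rightarrow> 'a" and E :: "'a \<Rightarrow> 'a" +
  fixes B :: "'a \<Rightarrow> 'a \<Rightarrow> 'k"
  assumes B_quadratic: "homogeneous_quadratic B"
    and E_degree: "x \<in> G \<alpha> \<Longrightarrow> E x \<in> G \<alpha>"
    and E_derivation: "E (bracket x y) = bracket (E x) y + bracket x (E y)"
    and E_skew: "B (E x) y = - B x (E y)"
    and E_injective: "E x = 0 \<Longrightarrow> x = 0"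
begin

lemma B_bilinear: "bilinear_map scale (*) B"
  using B_quadratic by (simp add: homogeneous_quadratic_def bilinear_form_def)

lemmas B_simps = bilinear_mapD[OF B_bilinear]

lemma B_nondegenerate: "(\<And>y. B x y = 0) \<Longrightarrow> x = 0"
  using B_quadratic by (simp add: homogeneous_quadratic_def nondegenerate_def)

lemma bracket_gen_eigenspace:
  assumes "x \<in> gen_eigenspace \<kappa>" "y \<in> gen_eigenspace \<mu>"
  shows "bracket x y \<in> gen_eigenspace (\<kappa> + \<mu>)"
  using assms
proof (induction arbitrary: y rule: gen_eigenspace_induct)
  case zero
  show ?case by (simp add: bracket_simps zero_in_gen_eigenspace)
next
  case (step x)
  note IH = step.IH
  from step.prems show ?case
  proof (induction rule: gen_eigenspace_induct)
    case zero
    show ?case by (simp add: bracket_simps zero_in_gen_eigenspace)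
  next
    case (step y)
    have "bracket (E x - scale \<kappa> x) y + bracket x (E y - scale \<mu> y) \<in> gen_eigenspace (\<kappa> + \<mu>)"
      using IH[OF gen_eigenspaceI[OF step.hyps]] step.IH
      by (rule subspace_add[OF subspace_gen_eigenspace])
    also have "bracket (E x - scale \<kappa> x) y + bracket x (E y - scale \<mu> y) =
        E (bracket x y) - scale (\<kappa> + \<mu>) (bracket x y)"
      by (simp add: bracket_simps E_derivation algebra_simps)
    finally show ?case by (rule gen_eigenspaceI)
  qed
qed

text \<open>
  Skewness moves \<open>E - \<kappa>\<close> from the left argument to \<open>-(E + \<kappa>)\<close> on the right, and \<open>E + \<kappa>\<close> is
  surjective on the generalized eigenspace for any eigenvalue but \<open>-\<kappa>\<close>.
\<close>

lemma B_gen_eigenspace: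
  assumes "x \<in> gen_eigenspace \<kappa>" "y \<in> gen_eigenspace \<mu>" "\<kappa> + \<mu> \<noteq> 0"
  shows "B x y = 0"
  using assms(1,2)
proof (induction arbitrary: y rule: gen_eigenspace_induct)
  case zero
  show ?case by (simp add: B_simps)
next
  case (step x)
  have "- \<kappa> \<noteq> \<mu>"
    using assms(3) by auto
  then obtain u where u: "u \<in> gen_eigenspace \<mu>" "E u - scale (- \<kappa>) u = y"
    using shift_surj_on_gen_eigenspace step.prems by blast
  have "B x y = - B (E x - scale \<kappa> x) u"
    by (simp add: u(2)[symmetric] B_simps E_skew)
  with step.IH[OF u(1)] show ?case by simp
qed

lemma gen_eigenspace_0: "gen_eigenspace 0 = {0}"
  using gen_eigenspace_zero_trivial[OF E_injective] zero_in_gen_eigenspace by blast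

lemma gen_eigenspace_components:
  assumes "x \<in> gen_eigenspace \<kappa>" "x0 \<in> G 0" "x1 \<in> G 1" "x = x0 + x1"
  shows "x0 \<in> gen_eigenspace \<kappa> \<and> x1 \<in> gen_eigenspace \<kappa>"
  using assms
proof (induction arbitrary: x0 x1 rule: gen_eigenspace_induct)
  case zero
  then have "x0 = scale (- 1) x1"
    by (simp add: eq_neg_iff_add_eq_0)
  then have "x0 \<in> G 1"
    using zero by (metis component_scale)
  then have "x0 = 0"
    using zero component_disjoint[of x0 0 1] by simp
  with zero show ?case by (simp add: zero_in_gen_eigenspace)
next
  case (step x)
  have "E x0 - scale \<kappa> x0 \<in> G 0" "E x1 - scale \<kappa> x1 \<in> G 1"
    using step.prems by (auto intro: subspace_diff[OF subspace_component] E_degree component_scale)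
  moreover have "E x - scale \<kappa> x = (E x0 - scale \<kappa> x0) + (E x1 - scale \<kappa> x1)"
    by (simp add: step.prems E.add scale_right_distrib)
  ultimately have "E x0 - scale \<kappa> x0 \<in> gen_eigenspace \<kappa>" "E x1 - scale \<kappa> x1 \<in> gen_eigenspace \<kappa>"
    using step.IH by blast+
  then show ?case by (intro conjI; elim gen_eigenspaceI)
qed

lemma span_gen_eigenspaces_UNIV: "span (\<Union>\<kappa>. gen_eigenspace \<kappa>) = UNIV"
  using finite_dimensional span_gen_eigenspaces by blast

definition weight_vectors :: "'a set" where
  "weight_vectors = (\<Union>\<kappa> \<alpha>. gen_eigenspace \<kappa> \<inter> G \<alpha>)"

lemma bracket_weight_vectors:
  assumes "x \<in> weight_vectors" "y \<in> weight_vectors"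
  shows "bracket x y \<in> weight_vectors"
proof -
  obtain \<kappa> \<alpha> \<mu> \<beta> where "x \<in> gen_eigenspace \<kappa>" "x \<in> G \<alpha>" "y \<in> gen_eigenspace \<mu>" "y \<in> G \<beta>"
    using assms by (auto simp: weight_vectors_def)
  then have "bracket x y \<in> gen_eigenspace (\<kappa> + \<mu>) \<inter> G (\<alpha> + \<beta>)"
    by (intro IntI bracket_gen_eigenspace bracket_degree)
  then show ?thesis unfolding weight_vectors_def by blast
qed

lemma span_weight_vectors: "span weight_vectors = UNIV"
proof -
  have "x \<in> span weight_vectors" if x: "x \<in> gen_eigenspace \<kappa>" for x \<kappa>
  proof -
    obtain x0 x1 where x01: "x0 \<in> G 0" "x1 \<in> G 1" "x = x0 + x1"
      using homogeneous_decomp by blast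
    then have "x0 \<in> gen_eigenspace \<kappa>" "x1 \<in> gen_eigenspace \<kappa>"
      using gen_eigenspace_components[OF x] by simp_all
    then have "x0 \<in> weight_vectors" "x1 \<in> weight_vectors"
      using x01 by (auto simp: weight_vectors_def)
    then show ?thesis
      unfolding x01(3) by (intro span_add span_base)
  qed
  then have "(\<Union>\<kappa>. gen_eigenspace \<kappa>) \<subseteq> span weight_vectors"
    by auto
  then have "span (\<Union>\<kappa>. gen_eigenspace \<kappa>) \<subseteq> span weight_vectors"
    by (rule span_minimal) (rule subspace_span)
  with span_gen_eigenspaces_UNIV show ?thesis by auto
qed

text \<open>
  Finitely many generalized eigenspaces, with eigenvalues in \<open>M\<close> say, span everything; one for an
  eigenvalue outside \<open>-M\<close> is orthogonal to all of them and therefore zero.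
\<close>

lemma finite_eigenvalues: "finite {\<kappa>. gen_eigenspace \<kappa> \<noteq> {0}}"
proof -
  obtain S where S: "finite S" "span S = UNIV"
    using finite_dimensional by blast
  have "\<exists>F. finite F \<and> F \<subseteq> (\<Union>\<kappa>. gen_eigenspace \<kappa>) \<and> v \<in> span F" for v
  proof -
    have "v \<in> span (\<Union>\<kappa>. gen_eigenspace \<kappa>)"
      by (simp add: span_gen_eigenspaces_UNIV)
    then obtain F r where "finite F" "F \<subseteq> (\<Union>\<kappa>. gen_eigenspace \<kappa>)" "v = (\<Sum>a\<in>F. scale (r a) a)"
      unfolding span_explicit by blast
    then show ?thesis
      by (intro exI[of _ F]) (auto intro: span_sum span_scale span_base)
  qed
  then obtain F where F: "\<And>v. finite (F v)" "\<And>v. F v \<subseteq> (\<Union>\<kappa>. gen_eigenspace \<kappa>)"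
    "\<And>v. v \<in> span (F v)"
    by metis
  define F' where "F' = (\<Union>v\<in>S. F v)"
  have "finite F'"
    using S F by (simp add: F'_def)
  have "S \<subseteq> span F'"
    using F(3) span_mono[of "F _" F'] by (fastforce simp: F'_def)
  then have span_F': "span F' = UNIV"
    using S(2) span_minimal[of S "span F'"] by auto
  have "\<forall>v\<in>F'. \<exists>\<kappa>. v \<in> gen_eigenspace \<kappa>"
    using F(2) by (auto simp: F'_def)
  then obtain m where m: "\<And>v. v \<in> F' \<Longrightarrow> v \<in> gen_eigenspace (m v)"
    by metis
  have "\<kappa> \<in> (\<lambda>v. - m v) ` F'" if \<kappa>: "gen_eigenspace \<kappa> \<noteq> {0}" for \<kappa>
  proof (rule ccontr)
    assume neg: "\<not> ?thesis"
    have "B x y = 0" if x: "x \<in> gen_eigenspace \<kappa>" for x y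
    proof -
      have "B x' v \<in> {0}" if "x' \<in> {x}" "v \<in> F'" for x' v
        using B_gen_eigenspace[OF x m[of v]] that neg by (force simp: add_eq_0_iff2)
      then have "B x y \<in> {0}"
        by (rule bilinear_map_span[OF B_bilinear subspace_zero_mult, where X = "{x}" and Y = F'])
          (simp_all add: span_base span_F')
      then show ?thesis by simp
    qed
    then have "gen_eigenspace \<kappa> \<subseteq> {0}"
      using B_nondegenerate by auto
    with \<kappa> zero_in_gen_eigenspace show False by auto
  qed
  then have "{\<kappa>. gen_eigenspace \<kappa> \<noteq> {0}} \<subseteq> (\<lambda>v. - m v) ` F'"
    by blast
  then show ?thesis
    by (rule finite_subset) (rule finite_imageI[OF \<open>finite F'\<close>])
qed

section \<open>The center\<close>

text \<open>
  Repeated bracketing with \<open>x\<close> moves a vector of weight \<open>\<mu>\<close> through the infinitely many weights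
  \<open>\<mu> + n \<kappa>\<close>, of which only finitely many occur.
\<close>

lemma ad_nilpotent:
  assumes x: "x \<in> gen_eigenspace \<kappa>" and "\<kappa> \<noteq> 0"
  shows "nil_part {bracket x} = UNIV"
proof -
  have sub: "subspace (nil_part {bracket x})"
    by (rule subspace_nil_part[OF vector_space_axioms]) (auto intro: linear_bracket)
  have "v \<in> nil_part {bracket x}" if v: "v \<in> gen_eigenspace \<mu>" for v \<mu>
  proof -
    have weight: "(bracket x ^^ n) v \<in> gen_eigenspace (\<mu> + of_nat n * \<kappa>)" for n
    proof (induction n)
      case (Suc n)
      from bracket_gen_eigenspace[OF x Suc] show ?case by (simp add: algebra_simps)
    qed (simp add: v)
    have "inj (\<lambda>n. \<mu> + of_nat n * \<kappa>)"
      using \<open>\<kappa> \<noteq> 0\<close> by (auto intro!: injI)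
    then have "infinite (range (\<lambda>n. \<mu> + of_nat n * \<kappa>))"
      using finite_imageD by blast
    then have "\<not> range (\<lambda>n. \<mu> + of_nat n * \<kappa>) \<subseteq> {\<kappa>. gen_eigenspace \<kappa> \<noteq> {0}}"
      using finite_eigenvalues finite_subset by metis
    then obtain n where "gen_eigenspace (\<mu> + of_nat n * \<kappa>) = {0}"
      by auto
    with weight[of n] show ?thesis by (intro nil_part_funpow[of n]) auto
  qed
  then have "span (\<Union>\<kappa>. gen_eigenspace \<kappa>) \<subseteq> nil_part {bracket x}"
    by (intro span_minimal sub) auto
  then show ?thesis
    unfolding span_gen_eigenspaces_UNIV by blast
qed

text \<open>
  The step of the induction in Engel's theorem: nilpotency of the action of \<open>T\<close> survives the
  adjunction of a weight vector \<open>x\<close> that normalizes the span of \<open>T\<close>. The vectors \<open>u\<close> with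
  \<open>[T, u]\<close> inside the new nilpotent part are preserved by \<open>ad x\<close>, and \<open>ad x\<close> is nilpotent, so all
  of them belong to the nilpotent part. Every vector of the old one is reached through them.
\<close>

lemma ad_nilpotent_insert:
  assumes T: "T \<subseteq> weight_vectors" "nil_part (bracket ` T) = UNIV"
    and x: "x \<in> weight_vectors" "\<And>t. t \<in> T \<Longrightarrow> bracket t x \<in> span T"
  shows "nil_part (bracket ` insert x T) = UNIV"
proof (cases "x = 0")
  case True
  have "v \<in> nil_part (bracket ` insert x T)" if "v \<in> nil_part (bracket ` T)" for v
    using that
  proof induction
    case zero
    show ?case by (rule nil_part.zero)
  next
    case (step v)
    show ?case
    proof (rule nil_part.step)
      fix \<phi> assume "\<phi> \<in> bracket ` insert x T"
      then consider "\<phi> = bracket 0" | "\<phi> \<in> bracket ` T"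
        using True by blast
      then show "\<phi> v \<in> nil_part (bracket ` insert x T)"
      proof cases
        case 1
        then show ?thesis by (simp add: bracket_simps nil_part.zero)
      next
        case 2
        then show ?thesis by (rule step.IH)
      qed
    qed
  qed
  with T(2) show ?thesis by blast
next
  case False
  let ?N = "nil_part (bracket ` insert x T)"
  have sub: "subspace ?N"
    by (rule subspace_nil_part[OF vector_space_axioms]) (auto intro: linear_bracket)
  obtain \<kappa> \<alpha> where xw: "x \<in> gen_eigenspace \<kappa>" "x \<in> G \<alpha>"
    using x(1) by (auto simp: weight_vectors_def)
  have "\<kappa> \<noteq> 0"
    using xw(1) False gen_eigenspace_0 by auto
  define Q where "Q = {u. \<forall>t\<in>T. bracket t u \<in> ?N}"
  have Q_span: "bracket k u \<in> ?N" if "k \<in> span T" "u \<in> Q" for k u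
    by (rule bilinear_map_span[OF bracket_bilinear sub _ that(1), where Y = "{u}"])
      (use that(2) in \<open>auto simp: Q_def span_base\<close>)
  have Q_stable: "bracket x u \<in> Q" if u: "u \<in> Q" for u
  proof -
    have "bracket t (bracket x u) \<in> ?N" if t: "t \<in> T" for t
    proof -
      obtain \<beta> where "t \<in> G \<beta>"
        using t T(1) by (auto simp: weight_vectors_def)
      then have "bracket t (bracket x u) =
          bracket (bracket t x) u + scale (super_sign \<beta> \<alpha>) (bracket x (bracket t u))"
        using xw(2) by (rule bracket_bracket)
      moreover have "bracket (bracket t x) u \<in> ?N"
        using x(2)[OF t] u by (rule Q_span)
      moreover have "bracket x (bracket t u) \<in> ?N"
        by (rule nil_part_stable[of "bracket t u" _ "bracket x"])
          (use u t in \<open>auto simp: Q_def bracket_simps\<close>)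
      ultimately show ?thesis
        by (simp only: subspace_add[OF sub] subspace_scale[OF sub])
    qed
    then show ?thesis by (simp add: Q_def)
  qed
  have Q_N: "u \<in> ?N" if "u \<in> Q" for u
  proof -
    have "u \<in> nil_part {bracket x}"
      using ad_nilpotent[OF xw(1) \<open>\<kappa> \<noteq> 0\<close>] by simp
    then show ?thesis
      using that
    proof induction
      case zero
      show ?case by (rule nil_part.zero)
    next
      case (step u)
      show ?case
      proof (rule nil_part.step)
        fix \<phi> assume "\<phi> \<in> bracket ` insert x T"
        then consider "\<phi> = bracket x" | t where "t \<in> T" "\<phi> = bracket t"
          by blast
        then show "\<phi> u \<in> ?N"
        proof cases
          case 1
          with step.IH[of "bracket x"] Q_stable[OF step.prems] show ?thesis by simp
        next
          case 2
          with step.prems show ?thesis by (simp add: Q_def)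
        qed
      qed
    qed
  qed
  have "v \<in> ?N" if "v \<in> nil_part (bracket ` T)" for v
    using that
  proof induction
    case zero
    show ?case by (rule nil_part.zero)
  next
    case (step v)
    then have "v \<in> Q"
      by (auto simp: Q_def)
    then show ?case by (rule Q_N)
  qed
  with T(2) show ?thesis by blast
qed

text \<open>
  Take a set of weight vectors that spans a subalgebra acting nilpotently, with span of largest
  dimension. If the span is proper, the last weight vector \<open>x\<close> outside it on a path of
  brackets with \<open>T\<close> normalizes it. An odd \<open>x\<close> need not span a subalgebra together with \<open>T\<close>, but then \<open>[x,x]\<close> is
  even, still normalizes, and commutes with itself. Adjoining it contradicts maximality.
\<close>

lemma superalgebra_nilpotent:
  obtains T where "T \<subseteq> weight_vectors" "span T = UNIV" "nil_part (bracket ` T) = UNIV"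
proof -
  obtain S where "finite S" "span S = UNIV"
    using finite_dimensional by blast
  then obtain Basis where "Basis \<subseteq> S" "independent Basis" "span Basis = UNIV"
    using maximal_independent_subset[of S] span_minimal[OF _ subspace_span]
    by (metis top.extremum_unique)
  with \<open>finite S\<close> interpret fd: finite_dimensional_vector_space scale Basis
    by unfold_locales (auto intro: finite_subset)
  define good where "good T \<longleftrightarrow> T \<subseteq> weight_vectors \<and> nil_part (bracket ` T) = UNIV \<and>
    (\<forall>s\<in>T. \<forall>t\<in>T. bracket s t \<in> span T)" for T
  have "good {}"
    by (auto simp: good_def intro: nil_part.step)
  then obtain T where "good T" and max: "\<And>T'. good T' \<Longrightarrow> dim (span T') \<le> dim (span T)"
    using ex_has_greatest_nat[of good "{}" "\<lambda>T. dim (span T)" "Suc fd.dimension"]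
      fd.dim_subset_UNIV less_Suc_eq_le by auto
  then have T: "T \<subseteq> weight_vectors" "nil_part (bracket ` T) = UNIV"
    "\<And>s t. s \<in> T \<Longrightarrow> t \<in> T \<Longrightarrow> bracket s t \<in> span T"
    by (auto simp: good_def)
  have max_insert: "x \<in> span T" if x: "x \<in> weight_vectors" "bracket x x \<in> span T"
    "\<And>t. t \<in> T \<Longrightarrow> bracket t x \<in> span T" for x
  proof (rule ccontr)
    assume "x \<notin> span T"
    have sub: "span T \<subseteq> span (insert x T)"
      by (rule span_mono) blast
    have xt: "bracket x t \<in> span T" if "t \<in> T" for t
    proof -
      obtain \<alpha> where xG: "x \<in> G \<alpha>"
        using x(1) unfolding weight_vectors_def by blast
      obtain \<beta> where tG: "t \<in> G \<beta>"
        using T(1) \<open>t \<in> T\<close> unfolding weight_vectors_def by blast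
      show ?thesis
        by (rule bracket_swap_in_subspace[OF subspace_span tG xG x(3)[OF \<open>t \<in> T\<close>]])
    qed
    have "nil_part (bracket ` insert x T) = UNIV"
      using T(1,2) x(1,3) by (rule ad_nilpotent_insert)
    moreover have "insert x T \<subseteq> weight_vectors"
      using T(1) x(1) by blast
    moreover have "\<forall>s\<in>insert x T. \<forall>t\<in>insert x T. bracket s t \<in> span (insert x T)"
      using x(2,3) xt T(3) sub by blast
    ultimately have "good (insert x T)"
      by (simp add: good_def)
    then have "dim (span (insert x T)) \<le> dim (span T)"
      by (rule max)
    then have "span T = span (insert x T)"
      using sub by (intro fd.subspace_dim_equal) auto
    with \<open>x \<notin> span T\<close> span_base[of x "insert x T"] show False by simp
  qed
  have "weight_vectors \<subseteq> span T"
  proof (rule ccontr)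
    assume "\<not> ?thesis"
    then obtain s where "s \<in> weight_vectors" "s \<notin> span T" by blast
    then have "\<exists>x\<in>weight_vectors - span T. \<forall>\<phi>\<in>bracket ` T. \<phi> x \<in> span T"
      by (intro nil_part_last_outside[of s])
        (use T(1,2) in \<open>auto simp: span_zero intro: bracket_weight_vectors\<close>)
    then obtain x where x: "x \<in> weight_vectors" "x \<notin> span T"
      and tx: "\<And>t. t \<in> T \<Longrightarrow> bracket t x \<in> span T"
      by auto
    obtain \<alpha> where xG: "x \<in> G \<alpha>"
      using x(1) unfolding weight_vectors_def by blast
    have "bracket x x \<in> span T"
    proof (rule max_insert)
      show "bracket x x \<in> weight_vectors"
        using x(1) by (intro bracket_weight_vectors)
      have "bracket x x \<in> G 0"
        using bracket_degree[OF xG xG] by (cases \<alpha>) simp_all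
      from bracket_skew[OF this this] have "scale 2 (bracket (bracket x x) (bracket x x)) = 0"
        by (simp add: scale_left_distrib[of 1 1, simplified] eq_neg_iff_add_eq_0)
      then show "bracket (bracket x x) (bracket x x) \<in> span T"
        by (simp add: span_zero)
      fix t assume t: "t \<in> T"
      then obtain \<beta> where tG: "t \<in> G \<beta>"
        using T(1) unfolding weight_vectors_def by blast
      have kx: "bracket k x \<in> span T" if "k \<in> span T" for k
        by (rule bilinear_map_span[OF bracket_bilinear subspace_span _ that, where Y = "{x}"])
          (auto simp: tx span_base)
      have 1: "bracket (bracket t x) x \<in> span T"
        by (rule kx[OF tx[OF t]])
      then have "bracket x (bracket t x) \<in> span T"
        by (rule bracket_swap_in_subspace[OF subspace_span bracket_degree[OF tG xG] xG])
      with 1 show "bracket t (bracket x x) \<in> span T"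
        unfolding bracket_bracket[OF tG xG] by (intro span_add span_scale)
    qed
    from max_insert[OF x(1) this tx] x(2) show False by blast
  qed
  then have "span weight_vectors \<subseteq> span T"
    by (rule span_minimal) (rule subspace_span)
  with span_weight_vectors have "span T = UNIV" by auto
  then show thesis by (rule that[OF T(1) _ T(2)])
qed

text \<open>
  The last nonzero vector on a path of brackets is central; starting from a weight vector it is
  itself a weight vector.
\<close>

lemma ex_central_weight_vector:
  assumes "\<exists>x::'a. x \<noteq> 0"
  obtains z \<kappa> where "z \<in> center" "z \<noteq> 0" "z \<in> gen_eigenspace \<kappa>" "\<kappa> \<noteq> 0"
proof -
  obtain T where T: "T \<subseteq> weight_vectors" "span T = UNIV" "nil_part (bracket ` T) = UNIV"
    by (rule superalgebra_nilpotent)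
  have "\<not> weight_vectors \<subseteq> {0}"
  proof
    assume "weight_vectors \<subseteq> {0}"
    then have "span weight_vectors \<subseteq> {0}"
      by (rule span_minimal) (rule subspace_single_0)
    with assms span_weight_vectors show False by auto
  qed
  then obtain s where "s \<in> weight_vectors" "s \<noteq> 0" by blast
  then have "\<exists>z\<in>weight_vectors - {0}. \<forall>\<phi>\<in>bracket ` T. \<phi> z \<in> {0}"
    by (intro nil_part_last_outside[of s])
      (use T(1,3) in \<open>auto intro: bracket_weight_vectors\<close>)
  then obtain z where z: "z \<in> weight_vectors" "z \<noteq> 0" and Tz: "\<And>t. t \<in> T \<Longrightarrow> bracket t z = 0"
    by auto
  have yz: "bracket y z = 0" for y
  proof -
    have "bracket y z \<in> {0}"
      by (rule bilinear_map_span[OF bracket_bilinear subspace_single_0, where X = T and Y = "{z}"])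
        (auto simp: T(2) Tz span_base)
    then show ?thesis by simp
  qed
  obtain \<kappa> \<alpha> where zw: "z \<in> gen_eigenspace \<kappa>" "z \<in> G \<alpha>"
    using z(1) by (auto simp: weight_vectors_def)
  have "bracket z y = 0" for y
  proof (induction y rule: homogeneous_induct)
    case (homogeneous \<beta> y)
    then show ?case using bracket_skew[OF zw(2) homogeneous] by (simp add: yz)
  next
    case (add y y')
    then show ?case by (simp add: bracket_simps)
  qed
  then have "z \<in> center"
    by (simp add: center_def)
  moreover have "\<kappa> \<noteq> 0"
    using zw(1) z(2) gen_eigenspace_0 by auto
  ultimately show thesis
    using z(2) zw(1) that by blast
qed

section \<open>The isotropic subalgebras of positive and negative weight\<close>

definition weight_sum :: "'k set \<Rightarrow> 'a set" where
  "weight_sum P = span (\<Union>\<kappa>\<in>P. gen_eigenspace \<kappa>)"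

lemma weight_sum_homogeneous_decomp:
  assumes "x \<in> weight_sum P"
  shows "\<exists>u\<in>weight_sum P \<inter> G 0. \<exists>v\<in>weight_sum P \<inter> G 1. x = u + v"
  using assms unfolding weight_sum_def
proof (induction rule: span_induct_alt)
  case base
  show ?case
    by (rule bexI[of _ 0], rule bexI[of _ 0])
      (auto simp: span_zero subspace_0[OF subspace_component])
next
  let ?W = "span (\<Union>\<kappa>\<in>P. gen_eigenspace \<kappa>)"
  case (step c x y)
  then obtain u v where uv: "u \<in> ?W \<inter> G 0" "v \<in> ?W \<inter> G 1" "y = u + v" by blast
  obtain x0 x1 where x01: "x0 \<in> G 0" "x1 \<in> G 1" "x = x0 + x1"
    using homogeneous_decomp by blast
  obtain \<kappa> where \<kappa>: "\<kappa> \<in> P" "x \<in> gen_eigenspace \<kappa>"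
    using step by blast
  then have "x0 \<in> gen_eigenspace \<kappa>" "x1 \<in> gen_eigenspace \<kappa>"
    using gen_eigenspace_components[OF \<kappa>(2) x01] by simp_all
  then have "x0 \<in> ?W" "x1 \<in> ?W"
    using \<kappa>(1) by (auto intro: span_base)
  with x01 uv have "scale c x0 + u \<in> ?W \<inter> G 0" "scale c x1 + v \<in> ?W \<inter> G 1"
    by (auto intro: span_add span_scale component_add component_scale)
  moreover have "scale c x + y = (scale c x0 + u) + (scale c x1 + v)"
    by (simp add: x01 uv scale_right_distrib algebra_simps)
  ultimately show ?case by blast
qed

lemma weight_sum_subalgebra:
  assumes "\<And>\<kappa> \<mu>. \<kappa> \<in> P \<Longrightarrow> \<mu> \<in> P \<Longrightarrow> \<kappa> + \<mu> \<in> P"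
  shows "lie_sub_superalgebra (weight_sum P)"
proof -
  have sub: "subspace (weight_sum P)"
    by (simp add: weight_sum_def)
  have "weight_sum P = {u + v |u v. u \<in> weight_sum P \<inter> G 0 \<and> v \<in> weight_sum P \<inter> G 1}"
  proof (intro equalityI subsetI)
    fix x assume "x \<in> weight_sum P"
    from weight_sum_homogeneous_decomp[OF this]
    show "x \<in> {u + v |u v. u \<in> weight_sum P \<inter> G 0 \<and> v \<in> weight_sum P \<inter> G 1}" by blast
  next
    fix x assume "x \<in> {u + v |u v. u \<in> weight_sum P \<inter> G 0 \<and> v \<in> weight_sum P \<inter> G 1}"
    then show "x \<in> weight_sum P" by (auto intro: subspace_add[OF sub])
  qed
  moreover have "(weight_sum P \<inter> G 0) \<inter> (weight_sum P \<inter> G 1) = {0}"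
    using component_disjoint[of _ 0 1] subspace_0[OF sub] subspace_0[OF subspace_component] by auto
  ultimately have "direct_sum (weight_sum P \<inter> G 0) (weight_sum P \<inter> G 1) (weight_sum P)"
    by (simp add: direct_sum_def)
  moreover have "bracket x y \<in> weight_sum P" if "x \<in> weight_sum P" "y \<in> weight_sum P" for x y
  proof (rule bilinear_map_span[OF bracket_bilinear sub _ that[unfolded weight_sum_def]])
    fix x y assume "x \<in> (\<Union>\<kappa>\<in>P. gen_eigenspace \<kappa>)" "y \<in> (\<Union>\<kappa>\<in>P. gen_eigenspace \<kappa>)"
    then obtain \<kappa> \<mu> where "\<kappa> \<in> P" "x \<in> gen_eigenspace \<kappa>" "\<mu> \<in> P" "y \<in> gen_eigenspace \<mu>"
      by blast
    then have "\<kappa> + \<mu> \<in> P" "bracket x y \<in> gen_eigenspace (\<kappa> + \<mu>)"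
      by (auto intro: assms bracket_gen_eigenspace)
    then show "bracket x y \<in> weight_sum P"
      unfolding weight_sum_def by (blast intro: span_base)
  qed
  ultimately show ?thesis
    using sub by (simp add: lie_sub_superalgebra_def)
qed

lemma weight_sum_isotropic:
  assumes "\<And>\<kappa> \<mu>. \<kappa> \<in> P \<Longrightarrow> \<mu> \<in> P \<Longrightarrow> \<kappa> + \<mu> \<noteq> 0"
  shows "totally_isotropic B (weight_sum P)"
  unfolding totally_isotropic_def
proof (intro ballI)
  fix x y assume "x \<in> weight_sum P" "y \<in> weight_sum P"
  then have "x \<in> span (\<Union>\<kappa>\<in>P. gen_eigenspace \<kappa>)" "y \<in> span (\<Union>\<kappa>\<in>P. gen_eigenspace \<kappa>)"
    by (simp_all add: weight_sum_def)
  then have "B x y \<in> {0}"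
  proof (rule bilinear_map_span[OF B_bilinear subspace_zero_mult, rotated])
    fix x y assume "x \<in> (\<Union>\<kappa>\<in>P. gen_eigenspace \<kappa>)" "y \<in> (\<Union>\<kappa>\<in>P. gen_eigenspace \<kappa>)"
    then show "B x y \<in> {0}"
      using B_gen_eigenspace assms by blast
  qed
  then show "B x y = 0" by simp
qed

lemma weight_sum_commuting_stable:
  assumes lin: "Vector_Spaces.linear scale scale D" and comm: "\<And>x. D (E x) = E (D x)"
    and "x \<in> weight_sum P"
  shows "D x \<in> weight_sum P"
proof -
  interpret D: Vector_Spaces.linear scale scale D by (rule lin)
  have "D ` (\<Union>\<kappa>\<in>P. gen_eigenspace \<kappa>) \<subseteq> (\<Union>\<kappa>\<in>P. gen_eigenspace \<kappa>)"
    using gen_eigenspace_commuting_stable[OF lin comm] by blast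
  then have "span (D ` (\<Union>\<kappa>\<in>P. gen_eigenspace \<kappa>)) \<subseteq> weight_sum P"
    unfolding weight_sum_def by (rule span_mono)
  moreover have "D x \<in> span (D ` (\<Union>\<kappa>\<in>P. gen_eigenspace \<kappa>))"
    using assms(3) unfolding weight_sum_def by (simp add: D.span_image)
  ultimately show ?thesis by blast
qed

text \<open>
  The intersection of the two halves is zero because both are isotropic and together they span the
  algebra, so that it is orthogonal to everything.
\<close>

lemma weight_sum_manin:
  assumes P_zero: "0 \<notin> P" and P_add: "\<And>\<kappa> \<mu>. \<kappa> \<in> P \<Longrightarrow> \<mu> \<in> P \<Longrightarrow> \<kappa> + \<mu> \<in> P"
    and P_total: "\<And>\<kappa>. \<kappa> \<noteq> 0 \<Longrightarrow> \<kappa> \<in> P \<or> - \<kappa> \<in> P"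
  shows "homogeneous_manin (weight_sum P) (weight_sum (uminus ` P)) B"
proof -
  let ?a = "weight_sum P" and ?b = "weight_sum (uminus ` P)"
  have iso: "totally_isotropic B ?a" "totally_isotropic B ?b"
  proof -
    show "totally_isotropic B ?a"
      by (rule weight_sum_isotropic) (use P_zero P_add in force)
    show "totally_isotropic B ?b"
    proof (rule weight_sum_isotropic)
      fix \<kappa> \<mu> assume "\<kappa> \<in> uminus ` P" "\<mu> \<in> uminus ` P"
      then obtain \<kappa>' \<mu>' where "\<kappa>' \<in> P" "\<mu>' \<in> P" "\<kappa> = - \<kappa>'" "\<mu> = - \<mu>'" by blast
      moreover from this have "\<kappa>' + \<mu>' \<noteq> 0"
        using P_add P_zero by metis
      ultimately show "\<kappa> + \<mu> \<noteq> 0"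
        by (metis add.inverse_inverse minus_add_distrib neg_equal_0_iff_equal add.commute)
    qed
  qed
  have "lie_sub_superalgebra ?a"
    by (rule weight_sum_subalgebra) (rule P_add)
  moreover have "lie_sub_superalgebra ?b"
  proof (rule weight_sum_subalgebra)
    fix \<kappa> \<mu> assume "\<kappa> \<in> uminus ` P" "\<mu> \<in> uminus ` P"
    then obtain \<kappa>' \<mu>' where "\<kappa>' \<in> P" "\<mu>' \<in> P" "\<kappa> = - \<kappa>'" "\<mu> = - \<mu>'" by blast
    then show "\<kappa> + \<mu> \<in> uminus ` P"
      by (intro image_eqI[of _ _ "\<kappa>' + \<mu>'"] P_add) simp_all
  qed
  moreover have sum: "UNIV = {u + v |u v. u \<in> ?a \<and> v \<in> ?b}"
  proof -
    let ?X = "(\<Union>\<kappa>\<in>P. gen_eigenspace \<kappa>) \<union> (\<Union>\<kappa>\<in>uminus ` P. gen_eigenspace \<kappa>)"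
    have "gen_eigenspace \<kappa> \<subseteq> span ?X" for \<kappa>
    proof (cases "\<kappa> = 0")
      case True
      then show ?thesis by (simp add: gen_eigenspace_0 span_zero)
    next
      case False
      with P_total consider "\<kappa> \<in> P" | "- \<kappa> \<in> P" by blast
      then have "\<kappa> \<in> P \<union> uminus ` P"
        by cases (auto intro: image_eqI[of _ _ "- \<kappa>"])
      then have "gen_eigenspace \<kappa> \<subseteq> ?X" by blast
      then show ?thesis using span_superset[of ?X] by (rule order_trans)
    qed
    then have "span (\<Union>\<kappa>. gen_eigenspace \<kappa>) \<subseteq> span ?X"
      by (intro span_minimal subspace_span) blast
    then have "UNIV = span ?X"
      using span_gen_eigenspaces_UNIV by auto
    then show ?thesis
      by (simp only: span_Un weight_sum_def)
  qed
  moreover have "?a \<inter> ?b = {0}"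
  proof (intro equalityI subsetI)
    fix x assume x: "x \<in> ?a \<inter> ?b"
    have "B x y = 0" for y
    proof -
      from sum obtain u v where "u \<in> ?a" "v \<in> ?b" "y = u + v" by blast
      with iso x show ?thesis by (simp add: totally_isotropic_def B_simps)
    qed
    then show "x \<in> {0}"
      using B_nondegenerate by simp
  qed (simp add: weight_sum_def span_zero)
  ultimately show ?thesis
    using iso B_quadratic by (simp add: homogeneous_manin_def direct_sum_def)
qed

end

section \<open>The derivation relating the two forms\<close>

text \<open>
  The square of an odd superderivation is half of its supercommutator with itself, and thus an even
  derivation; the square of an even one is in general not a derivation.
\<close>

definition even_iterate :: "bit \<Rightarrow> ('a \<Rightarrow> 'a) \<Rightarrow> 'a \<Rightarrow> 'a" where
  "even_iterate p D = (if p = 0 then D else D \<circ> D)"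

context lie_superalgebra
begin

lemma homogeneous_form_degree:
  assumes "homogeneous_form \<theta>"
  shows "\<exists>\<delta>. \<forall>\<alpha> \<beta>. \<forall>x\<in>G \<alpha>. \<forall>y\<in>G \<beta>. \<beta> \<noteq> \<alpha> + \<delta> \<longrightarrow> \<theta> x y = 0"
  using assms unfolding homogeneous_form_def
proof
  assume "even_form \<theta>"
  then show ?thesis
    unfolding even_form_def by (intro exI[of _ 0]) (metis add.right_neutral)
next
  assume odd: "odd_form \<theta>"
  have "\<beta> = \<alpha>" if "\<beta> \<noteq> \<alpha> + 1" for \<alpha> \<beta> :: bit
    using that by (cases \<alpha>; cases \<beta>) auto
  with odd show ?thesis
    unfolding odd_form_def by (intro exI[of _ 1]) metis
qed

text \<open>
  With respect to a basis \<open>b\<close>, the map \<open>x \<mapsto> \<Sum>b. \<theta>(x,b) b\<close> records the functional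
  \<open>\<theta>(x, -)\<close> as a vector, and composing the one for \<open>\<omega>\<close> with the inverse of the one for \<open>B\<close>
  represents \<open>\<omega>\<close> by \<open>B\<close>.
\<close>

lemma ex_representing_operator:
  assumes B: "bilinear_form B" "nondegenerate B" and \<omega>: "bilinear_form \<omega>"
  obtains D where "Vector_Spaces.linear scale scale D" "\<And>x y. \<omega> x y = B (D x) y"
proof -
  obtain S where "finite S" "span S = UNIV"
    using finite_dimensional by blast
  then obtain Basis where "Basis \<subseteq> S" "independent Basis" "span Basis = UNIV"
    using maximal_independent_subset[of S] span_minimal[OF _ subspace_span]
    by (metis top.extremum_unique)
  with \<open>finite S\<close> interpret fd: finite_dimensional_vector_space scale Basis
    by unfold_locales (auto intro: finite_subset)
  define R where "R \<theta> x = (\<Sum>b\<in>Basis. scale (\<theta> x b) b)" for \<theta> :: "'a \<Rightarrow> 'a \<Rightarrow> 'k" and x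
  have R_linear: "Vector_Spaces.linear scale scale (R \<theta>)" if "bilinear_form \<theta>" for \<theta>
  proof unfold_locales
    note \<theta> = bilinear_mapD[OF that[unfolded bilinear_form_def]]
    show "R \<theta> (x + y) = R \<theta> x + R \<theta> y" "R \<theta> (scale c x) = scale c (R \<theta> x)" for c x y
      by (simp_all add: R_def \<theta> scale_left_distrib sum.distrib scale_sum_right)
  qed
  have R_eq: "\<theta> x y = \<eta> x' y"
    if forms: "bilinear_form \<theta>" "bilinear_form \<eta>" and eq: "R \<theta> x = R \<eta> x'" for \<theta> \<eta> x x' y
  proof -
    have "(\<Sum>b\<in>Basis. scale (\<theta> x b - \<eta> x' b) b) = 0"
      using eq by (simp add: R_def scale_left_diff_distrib sum_subtractf)
    then have "\<theta> x b - \<eta> x' b = 0" if "b \<in> Basis" for b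
      by (rule independentD[OF \<open>independent Basis\<close> fd.finite_Basis order_refl _ that])
    then have basis: "\<theta> x b = \<eta> x' b" if "b \<in> Basis" for b
      using that by simp
    have lin: "Vector_Spaces.linear scale (*) (\<theta> x)" "Vector_Spaces.linear scale (*) (\<eta> x')"
      using forms by (auto simp: bilinear_form_def bilinear_map_def)
    interpret vector_space_pair scale "(*) :: 'k \<Rightarrow> 'k \<Rightarrow> 'k"
      by (intro vector_space_pair.intro vector_space_axioms vector_space_mult)
    show ?thesis
      by (rule linear_eq_on[OF lin, of _ Basis]) (simp_all add: \<open>span Basis = UNIV\<close> basis)
  qed
  have "inj (R B)"
  proof (rule injI)
    fix x x' assume "R B x = R B x'"
    then have "B (x - x') y = 0" for y
      using R_eq[OF B(1) B(1), of x x' y] bilinear_mapD(3)[OF B(1)[unfolded bilinear_form_def]]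
      by simp
    then have "x - x' = 0"
      using B(2) unfolding nondegenerate_def by blast
    then show "x = x'" by simp
  qed
  have "surj (R B)"
    by (rule fd.linear_inj_imp_surj[OF R_linear[OF B(1)] \<open>inj (R B)\<close>])
  have "Vector_Spaces.linear scale scale (inv (R B))"
    by (rule fd.inj_linear_imp_inv_linear[OF R_linear[OF B(1)] \<open>inj (R B)\<close>])
  then have "Vector_Spaces.linear scale scale (inv (R B) \<circ> R \<omega>)"
    by (rule Vector_Spaces.linear_compose[OF R_linear[OF \<omega>]])
  moreover have "\<omega> x y = B ((inv (R B) \<circ> R \<omega>) x) y" for x y
    by (rule R_eq[OF \<omega> B(1)]) (simp add: surj_f_inv_f[OF \<open>surj (R B)\<close>])
  ultimately show thesis by (rule that)
qed

context
  fixes B \<omega> :: "'a \<Rightarrow> 'a \<Rightarrow> 'k" and D :: "'a \<Rightarrow> 'a"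
  assumes B_quadratic: "homogeneous_quadratic B"
    and \<omega>_symplectic: "homogeneous_symplectic \<omega>"
    and D_linear: "Vector_Spaces.linear scale scale D"
    and \<omega>_eq: "\<omega> x y = B (D x) y"
begin

interpretation D: Vector_Spaces.linear scale scale D by (rule D_linear)

lemma forms_bilinear:
  "bilinear_map scale (*) B" "bilinear_map scale (*) \<omega>"
  using B_quadratic \<omega>_symplectic
  by (simp_all add: homogeneous_quadratic_def homogeneous_symplectic_def bilinear_form_def)

lemma form_left_cancel:
  assumes "\<And>\<gamma> z. z \<in> G \<gamma> \<Longrightarrow> B u z = B v z"
  shows "u = v"
proof -
  have "B (u - v) z = 0" for z
  proof (induction z rule: homogeneous_induct)
    case (homogeneous \<gamma> z)
    then show ?case by (simp add: bilinear_mapD[OF forms_bilinear(1)] assms)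
  next
    case (add z z')
    then show ?case by (simp add: bilinear_mapD[OF forms_bilinear(1)])
  qed
  then have "u - v = 0"
    using B_quadratic unfolding homogeneous_quadratic_def nondegenerate_def by blast
  then show ?thesis by simp
qed

lemma representing_operator_injective:
  assumes "D x = 0"
  shows "x = 0"
proof -
  have "\<omega> x y = 0" for y
    by (simp add: \<omega>_eq assms bilinear_mapD[OF forms_bilinear(1)])
  then show ?thesis
    using \<omega>_symplectic by (simp add: homogeneous_symplectic_def nondegenerate_def)
qed

text \<open>
  By homogeneity and non-degeneracy, the pairing of \<open>D x\<close> with homogeneous vectors determines its
  degree: the degree of \<open>D\<close> is the sum of the degrees of the forms.
\<close>

lemma representing_operator_degree:
  "\<exists>p. \<forall>\<alpha>. \<forall>x\<in>G \<alpha>. D x \<in> G (\<alpha> + p)"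
proof -
  obtain b where b: "\<And>\<alpha> \<beta> x y. x \<in> G \<alpha> \<Longrightarrow> y \<in> G \<beta> \<Longrightarrow> \<beta> \<noteq> \<alpha> + b \<Longrightarrow> B x y = 0"
    using B_quadratic homogeneous_form_degree unfolding homogeneous_quadratic_def by metis
  obtain w where w: "\<And>\<alpha> \<beta> x y. x \<in> G \<alpha> \<Longrightarrow> y \<in> G \<beta> \<Longrightarrow> \<beta> \<noteq> \<alpha> + w \<Longrightarrow> \<omega> x y = 0"
    using \<omega>_symplectic homogeneous_form_degree unfolding homogeneous_symplectic_def by metis
  have "D x \<in> G (\<alpha> + (b + w))" if x: "x \<in> G \<alpha>" for \<alpha> x
  proof -
    obtain u v where uv: "u \<in> G (\<alpha> + (b + w))" "v \<in> G (\<alpha> + (b + w) + 1)" "D x = u + v"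
    proof -
      obtain x0 x1 where "x0 \<in> G 0" "x1 \<in> G 1" "D x = x0 + x1"
        using homogeneous_decomp by blast
      then show thesis
        by (cases "\<alpha> + (b + w)") (auto intro: that[of x0 x1] that[of x1 x0] simp: add.commute)
    qed
    \<comment> \<open>Only elements \<open>z\<close> of degree \<open>\<alpha> + w + 1\<close> pair with \<open>v\<close>, and these pair to zero with \<open>x\<close>
      under \<open>\<omega>\<close> and with \<open>u\<close> under \<open>B\<close>.\<close>
    have "B v z = B 0 z" if z: "z \<in> G \<gamma>" for \<gamma> z
    proof (cases "\<gamma> = \<alpha> + w + 1")
      case True
      have "B u z = 0"
        by (rule b[OF uv(1) z]) (cases \<alpha>; cases b; cases w; simp add: True)
      moreover have "B (D x) z = 0"
        using w[OF x z] True by (cases \<alpha>; cases w) (simp_all add: \<omega>_eq)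
      ultimately show ?thesis
        by (simp add: uv(3) bilinear_mapD[OF forms_bilinear(1)])
    next
      case False
      have "B v z = 0"
        by (rule b[OF uv(2) z]) (use False in \<open>cases \<alpha>; cases b; cases w; simp\<close>)
      then show ?thesis by (simp add: bilinear_mapD[OF forms_bilinear(1)])
    qed
    then have "v = 0" by (rule form_left_cancel)
    with uv show ?thesis by simp
  qed
  then show ?thesis by blast
qed

context
  fixes p :: bit
  assumes D_degree: "x \<in> G \<alpha> \<Longrightarrow> D x \<in> G (\<alpha> + p)"
begin

text \<open>
  Closedness of \<open>\<omega>\<close> read through \<open>\<omega>(x,y) = B(D x, y)\<close>: by invariance, all three terms become
  \<open>B\<close> of something with \<open>z\<close>.
\<close>

lemma representing_operator_derivation:
  assumes x: "x \<in> G \<alpha>" and y: "y \<in> G \<beta>"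
  shows "D (bracket x y) = bracket (D x) y + scale (super_sign p \<alpha>) (bracket x (D y))"
proof (rule form_left_cancel)
  fix \<gamma> z assume z: "z \<in> G \<gamma>"
  note B = bilinear_mapD[OF forms_bilinear(1)] and W = bilinear_mapD[OF forms_bilinear(2)]
  have inv: "B (bracket u v) w = B u (bracket v w)" for u v w
    using B_quadratic by (simp add: homogeneous_quadratic_def invariant_form_def)
  have closed: "super_sign \<gamma> \<alpha> * \<omega> x (bracket y z) + super_sign \<alpha> \<beta> * \<omega> y (bracket z x) +
      super_sign \<beta> \<gamma> * \<omega> z (bracket x y) = 0"
    using \<omega>_symplectic x y z unfolding homogeneous_symplectic_def closed_form_def by blast
  have 1: "\<omega> x (bracket y z) = B (bracket (D x) y) z"
    by (simp add: \<omega>_eq inv)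
  have "\<omega> y (bracket z x) = - super_sign \<gamma> \<alpha> * B (D y) (bracket x z)"
    by (simp add: \<omega>_eq bracket_skew[OF z x] B)
  also have "B (D y) (bracket x z) = B (bracket (D y) x) z"
    by (simp add: inv)
  also have "\<dots> = - super_sign (\<beta> + p) \<alpha> * B (bracket x (D y)) z"
    by (subst bracket_skew[OF D_degree[OF y] x]) (simp add: B)
  finally have 2: "\<omega> y (bracket z x) =
      - super_sign \<gamma> \<alpha> * (- super_sign (\<beta> + p) \<alpha> * B (bracket x (D y)) z)" .
  have "\<omega> z (bracket x y) = - super_sign \<gamma> (\<alpha> + \<beta>) * \<omega> (bracket x y) z"
    using \<omega>_symplectic z bracket_degree[OF x y]
    unfolding homogeneous_symplectic_def skew_supersymmetric_def by blast
  then have 3: "\<omega> z (bracket x y) = - super_sign \<gamma> (\<alpha> + \<beta>) * B (D (bracket x y)) z"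
    by (simp only: \<omega>_eq)
  have "B (D (bracket x y)) z = B (bracket (D x) y) z + super_sign p \<alpha> * B (bracket x (D y)) z"
    using closed unfolding 1 2 3
    by (cases \<alpha>; cases \<beta>; cases \<gamma>; cases p) (simp_all add: algebra_simps eq_neg_iff_add_eq_0 add_eq_0_iff)
  then show "B (D (bracket x y)) z =
      B (bracket (D x) y + scale (super_sign p \<alpha>) (bracket x (D y))) z"
    by (simp add: B)
qed

lemma representing_operator_skew:
  assumes x: "x \<in> G \<alpha>"
  shows "B (D x) y = - super_sign p \<alpha> * B x (D y)"
proof (induction y rule: homogeneous_induct)
  case (homogeneous \<beta> y)
  have "\<omega> x y = - super_sign \<alpha> \<beta> * \<omega> y x"
    using \<omega>_symplectic x homogeneous
    unfolding homogeneous_symplectic_def skew_supersymmetric_def by blast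
  moreover have "B (D y) x = super_sign (\<beta> + p) \<alpha> * B x (D y)"
    using B_quadratic x D_degree[OF homogeneous]
    unfolding homogeneous_quadratic_def supersymmetric_def by blast
  ultimately show ?case
    by (cases \<alpha>; cases \<beta>; cases p) (simp_all add: \<omega>_eq)
next
  case (add y y')
  then show ?case by (simp add: bilinear_mapD[OF forms_bilinear(1)] D.add algebra_simps)
qed

lemma even_iterate_degree:
  assumes "x \<in> G \<alpha>"
  shows "even_iterate p D x \<in> G \<alpha>"
proof (cases p)
  case zero
  with D_degree[OF assms] show ?thesis by (cases \<alpha>) (simp_all add: even_iterate_def)
next
  case one
  with D_degree[OF D_degree[OF assms]] show ?thesis
    by (cases \<alpha>) (simp_all add: even_iterate_def)
qed

lemma even_iterate_derivation:
  "even_iterate p D (bracket x y) = bracket (even_iterate p D x) y + bracket x (even_iterate p D y)"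
proof (induction x rule: homogeneous_induct)
  case (homogeneous \<alpha> x)
  note x = homogeneous
  show ?case
  proof (induction y rule: homogeneous_induct)
    case (homogeneous \<beta> y)
    note y = homogeneous
    show ?case
    proof (cases p)
      case zero
      with representing_operator_derivation[OF x y] show ?thesis
        by (simp add: even_iterate_def)
    next
      case one
      have "D (D (bracket x y)) =
          D (bracket (D x) y) + scale (super_sign p \<alpha>) (D (bracket x (D y)))"
        by (simp add: representing_operator_derivation[OF x y] D.add D.scale)
      also have "\<dots> = bracket (D (D x)) y + bracket x (D (D y))"
        unfolding representing_operator_derivation[OF D_degree[OF x] y]
          representing_operator_derivation[OF x D_degree[OF y]] one
        by (cases \<alpha>) (simp_all add: algebra_simps)
      finally show ?thesis
        using one by (simp add: even_iterate_def)
    qed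
  next
    case (add y y')
    then show ?case by (simp add: bracket_simps even_iterate_def D.add algebra_simps split: if_splits)
  qed
next
  case (add x x')
  then show ?case by (simp add: bracket_simps even_iterate_def D.add algebra_simps split: if_splits)
qed

lemma even_iterate_skew: "B (even_iterate p D x) y = - B x (even_iterate p D y)"
proof (induction x rule: homogeneous_induct)
  case (homogeneous \<alpha> x)
  then show ?case
    using representing_operator_skew[OF homogeneous, of y]
      representing_operator_skew[OF D_degree[OF homogeneous], of y]
      representing_operator_skew[OF homogeneous, of "D y"]
    by (cases p; cases \<alpha>) (simp_all add: even_iterate_def)
next
  case (add x x')
  then show ?case
    by (simp add: bilinear_mapD[OF forms_bilinear(1)] even_iterate_def D.add split: if_splits)
qed

lemma even_iterate_linear: "Vector_Spaces.linear scale scale (even_iterate p D)"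
  using D_linear Vector_Spaces.linear_compose[OF D_linear D_linear] by (simp add: even_iterate_def)

lemma even_iterate_commutes: "D (even_iterate p D x) = even_iterate p D (D x)"
  by (simp add: even_iterate_def)

lemma even_iterate_injective: "even_iterate p D x = 0 \<Longrightarrow> x = 0"
  using representing_operator_injective by (auto simp: even_iterate_def split: if_splits)

end

end

end

section \<open>The Manin decomposition\<close>

theorem theorem6p4:
  fixes scale :: "'k::{alg_closed_field, field_char_0} \<Rightarrow> 'a::ab_group_add \<Rightarrow> 'a"
    and G :: "bit \<Rightarrow> 'a set"
    and bracket :: "'a \<Rightarrow> 'a \<Rightarrow> 'a"
    and B \<omega> :: "'a \<Rightarrow> 'a \<Rightarrow> 'k"
  assumes "lie_superalgebra scale G bracket"
    and "\<exists>x::'a. x \<noteq> 0"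
    and "lie_superalgebra.homogeneous_quadratic scale G bracket B"
    and "lie_superalgebra.homogeneous_symplectic scale G bracket \<omega>"
  shows "\<exists>\<aa> \<bb>.
    lie_superalgebra.special_homogeneous_symplectic_manin scale G bracket \<aa> \<bb> B \<omega> \<and>
    (lie_superalgebra.center bracket \<inter> \<aa> \<noteq> {0} \<or> lie_superalgebra.center bracket \<inter> \<bb> \<noteq> {0})"
proof -
  interpret lie_superalgebra scale G bracket by fact
  have B: "homogeneous_quadratic B" and \<omega>: "homogeneous_symplectic \<omega>" by fact+
  have forms: "bilinear_form B" "nondegenerate B" "bilinear_form \<omega>"
    using B \<omega> by (simp_all add: homogeneous_quadratic_def homogeneous_symplectic_def)
  obtain D where D: "Vector_Spaces.linear scale scale D" "\<And>x y. \<omega> x y = B (D x) y"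
    using ex_representing_operator[OF forms] by blast
  obtain p where p: "\<And>\<alpha> x. x \<in> G \<alpha> \<Longrightarrow> D x \<in> G (\<alpha> + p)"
    using representing_operator_degree[OF B \<omega> D] by blast
  define E where "E = even_iterate p D"
  have "Vector_Spaces.linear scale scale E"
    unfolding E_def by (rule even_iterate_linear[OF B \<omega> D p])
  moreover have "E x \<in> G \<alpha>" if "x \<in> G \<alpha>" for x \<alpha>
    unfolding E_def by (rule even_iterate_degree[OF B \<omega> D p that])
  moreover have "E (bracket x y) = bracket (E x) y + bracket x (E y)" for x y
    unfolding E_def by (rule even_iterate_derivation[OF B \<omega> D p])
  moreover have "B (E x) y = - B x (E y)" for x y
    unfolding E_def by (rule even_iterate_skew[OF B \<omega> D p])
  moreover have "x = 0" if "E x = 0" for x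
    using that unfolding E_def by (rule even_iterate_injective[OF B \<omega> D p, rotated])
  ultimately interpret invertible_skew_derivation scale G bracket E B
    by (intro invertible_skew_derivation.intro lie_superalgebra_axioms linear_operator.intro
        vector_space_axioms linear_operator_axioms.intro invertible_skew_derivation_axioms.intro B)
  have comm: "D (E x) = E (D x)" for x
    unfolding E_def by (rule even_iterate_commutes[OF B \<omega> D p])
  obtain P :: "'k set" where P: "0 \<notin> P" "\<And>\<kappa> \<mu>. \<kappa> \<in> P \<Longrightarrow> \<mu> \<in> P \<Longrightarrow> \<kappa> + \<mu> \<in> P"
    "\<And>\<kappa>. \<kappa> \<noteq> 0 \<Longrightarrow> \<kappa> \<in> P \<or> - \<kappa> \<in> P"
    by (rule ex_positive_cone) blast
  let ?a = "weight_sum P" and ?b = "weight_sum (uminus ` P)"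
  have manin: "homogeneous_manin ?a ?b B"
    using P by (rule weight_sum_manin)
  have \<omega>_isotropic: "totally_isotropic \<omega> (weight_sum Q)"
    if "totally_isotropic B (weight_sum Q)" for Q
    using that weight_sum_commuting_stable[OF D(1) comm]
    by (simp add: totally_isotropic_def D(2))
  have "special_homogeneous_symplectic_manin ?a ?b B \<omega>"
    using manin \<omega> \<omega>_isotropic
    by (simp add: special_homogeneous_symplectic_manin_def homogeneous_manin_def)
  moreover have "center \<inter> ?a \<noteq> {0} \<or> center \<inter> ?b \<noteq> {0}"
  proof -
    obtain z \<kappa> where z: "z \<in> center" "z \<noteq> 0" "z \<in> gen_eigenspace \<kappa>" "\<kappa> \<noteq> 0"
      by (rule ex_central_weight_vector[OF assms(2)])
    have mem: "z \<in> weight_sum Q" if "\<kappa> \<in> Q" for Q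
      unfolding weight_sum_def using that z(3) by (intro span_base) blast
    from P(3)[OF z(4)] show ?thesis
    proof
      assume "\<kappa> \<in> P"
      with z mem show ?thesis by blast
    next
      assume "- \<kappa> \<in> P"
      then have "\<kappa> \<in> uminus ` P"
        by (rule image_eqI[rotated]) simp
      with z mem show ?thesis by blast
    qed
  qed
  ultimately show ?thesis by blast
qed

end
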